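(* Let $k$ be a commutative ring and $A$ a $k$-algebra with unit map $u_A:k\to A$. Then: (1) If a monomial $x\otimes y\otimes z$ (with $x,y,z\in A$) is a canonical $R$-matrix for $A$, then it is equal to $1\otimes 1\otimes 1$. (2) $1\otimes 1\otimes 1$ is a canonical $R$-matrix for $A$ if and only if $u_A:k\to A$ is an epimorphism of rings. (3) If $A$ is commutative, then an element $R\in A^{(3)}$ is a canonical $R$-matrix for $A$ if and only if $R=1\otimes 1\otimes 1$ and $u_A:k\to A$ is an epimorphism of rings.
   Context: Algebras are associative and unital; an epimorphism of rings is an epimorphism in the category of (unital, associative) rings. $\otimes=\otimes_k$, and $A^{(n)}=A\otimes\cdots\otimes A$ ($n$ factors), with its tensor product algebra structure. An element $R\in A^{(3)}$ is written $R=R^1\otimes R^2\otimes R^3$ with summation implicitly understood. A canonical $R$-matrix for $A$ is an invertible element $R$ of the algebra $A^{(3)}$ such that, with $r=r^1\otimes r^2\otimes r^3$ a second copy of $R$, for all $a\in A$: $R^1\otimes R^2\otimes aR^3=R^1a\otimes R^2\otimes R^3$; $aR^1\otimes R^2\otimes R^3=R^1\otimes R^2a\otimes R^3$; $R^1\otimes aR^2\otimes R^3=R^1\otimes R^2\otimes R^3a$; $R^1\otimes R^2\otimes 1\otimes R^3=r^1R^1\otimes r^2\otimes r^3R^2\otimes R^3$; $R^1\otimes 1\otimes R^2\otimes R^3=R^1\otimes R^2r^1\otimes r^2\otimes R^3r^3$. *)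

theory Defs
  imports
    "HOL-Algebra.Module"
    "HOL-Algebra.QuotRing"
    "HOL-Algebra.Generated_Groups"
    "HOL-Algebra.Subrings"
    "HOL-Algebra.Weak_Morphisms"
    "HOL-Library.Poly_Mapping"
begin

section \<open>Associative unital algebras over a commutative ring\<close>

text \<open>
  The library locale \<^locale>\<open>algebra\<close> requires the algebra to be commutative.  The algebras
  below need not be; in particular the zero ring is allowed both as base and as algebra.
\<close>

locale assoc_algebra = module K A + A?: ring A
  for K :: "('k, 'p) ring_scheme" (structure)
    and A :: "('k, 'a, 'm) module_scheme" (structure) +
  assumes smult_mult_left:
      "\<lbrakk>c \<in> carrier K; x \<in> carrier A; y \<in> carrier A\<rbrakk> \<Longrightarrow>
        (c \<odot>\<^bsub>A\<^esub> x) \<otimes>\<^bsub>A\<^esub> y = c \<odot>\<^bsub>A\<^esub> (x \<otimes>\<^bsub>A\<^esub> y)"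
    and smult_mult_right:
      "\<lbrakk>c \<in> carrier K; x \<in> carrier A; y \<in> carrier A\<rbrakk> \<Longrightarrow>
        x \<otimes>\<^bsub>A\<^esub> (c \<odot>\<^bsub>A\<^esub> y) = c \<odot>\<^bsub>A\<^esub> (x \<otimes>\<^bsub>A\<^esub> y)"

definition unit_map :: "('k, 'a, 'm) module_scheme \<Rightarrow> 'k \<Rightarrow> 'a" where
  "unit_map A c = c \<odot>\<^bsub>A\<^esub> \<one>\<^bsub>A\<^esub>"


section \<open>Tensor powers\<close>

text \<open>
  For \<open>n \<ge> 1\<close>, the \<open>n\<close>-fold tensor power of \<open>A\<close> over \<open>K\<close> is the free abelian group on the
  \<open>n\<close>-tuples of elements of \<open>A\<close>, modulo additivity in each slot and modulo moving a scalar
  from one slot to another.  The free abelian group carries the slotwise product of tuples,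
  extended biadditively, and the tensor product algebra is the quotient ring.
\<close>

definition tuples :: "('a, 'm) ring_scheme \<Rightarrow> nat \<Rightarrow> 'a list set" where
  "tuples A n = {t. length t = n \<and> set t \<subseteq> carrier A}"

definition free_tuple_ring :: "('a, 'm) ring_scheme \<Rightarrow> nat \<Rightarrow> ('a list \<Rightarrow>\<^sub>0 int) ring" where
  "free_tuple_ring A n =
    \<lparr>carrier = {f. Poly_Mapping.keys f \<subseteq> tuples A n},
     mult = (\<lambda>f g. frag_extend (\<lambda>s. frag_extend (\<lambda>t. frag_of (map2 (\<otimes>\<^bsub>A\<^esub>) s t)) g) f),
     one = frag_of (replicate n \<one>\<^bsub>A\<^esub>),
     zero = 0,
     add = (+)\<rparr>"

definition tensor_relators ::
  "('k, 'p) ring_scheme \<Rightarrow> ('k, 'a, 'm) module_scheme \<Rightarrow> nat \<Rightarrow> ('a list \<Rightarrow>\<^sub>0 int) set" where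
  "tensor_relators K A n =
    {frag_of (t[i := x \<oplus>\<^bsub>A\<^esub> y]) - frag_of (t[i := x]) - frag_of (t[i := y]) | t i x y.
       t \<in> tuples A n \<and> i < n \<and> x \<in> carrier A \<and> y \<in> carrier A} \<union>
    {frag_of (t[i := c \<odot>\<^bsub>A\<^esub> (t ! i)]) - frag_of (t[j := c \<odot>\<^bsub>A\<^esub> (t ! j)]) | t i j c.
       t \<in> tuples A n \<and> i < n \<and> j < n \<and> c \<in> carrier K}"

definition tensor_null ::
  "('k, 'p) ring_scheme \<Rightarrow> ('k, 'a, 'm) module_scheme \<Rightarrow> nat \<Rightarrow> ('a list \<Rightarrow>\<^sub>0 int) set" where
  "tensor_null K A n = generate (add_monoid (free_tuple_ring A n)) (tensor_relators K A n)"

definition tensor_power ::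
  "('k, 'p) ring_scheme \<Rightarrow> ('k, 'a, 'm) module_scheme \<Rightarrow> nat \<Rightarrow> ('a list \<Rightarrow>\<^sub>0 int) set ring" where
  "tensor_power K A n = free_tuple_ring A n Quot tensor_null K A n"

text \<open>\<open>tensor K A [x\<^sub>1, \<dots>, x\<^sub>n]\<close> is the monomial \<open>x\<^sub>1 \<otimes> \<dots> \<otimes> x\<^sub>n\<close>.\<close>

definition tensor ::
  "('k, 'p) ring_scheme \<Rightarrow> ('k, 'a, 'm) module_scheme \<Rightarrow> 'a list \<Rightarrow> ('a list \<Rightarrow>\<^sub>0 int) set" where
  "tensor K A xs = tensor_null K A (length xs) +>\<^bsub>free_tuple_ring A (length xs)\<^esub> frag_of xs"


section \<open>Canonical R-matrices\<close>

text \<open>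
  The notation \<open>R = R\<^sup>1 \<otimes> R\<^sup>2 \<otimes> R\<^sup>3\<close> with implicit summation stands for a decomposition
  \<open>R = (\<Sum>i<n. x i \<otimes> y i \<otimes> z i)\<close>; a second copy \<open>r\<close> of \<open>R\<close> is the same sum with an independent
  summation index \<open>j\<close>.  Every element has such a decomposition, and both sides of each of the
  five identities come from additive maps on tensor powers, so that the choice is immaterial.
\<close>

definition canonical_R_matrix ::
  "('k, 'p) ring_scheme \<Rightarrow> ('k, 'a, 'm) module_scheme \<Rightarrow> ('a list \<Rightarrow>\<^sub>0 int) set \<Rightarrow> bool" where
  "canonical_R_matrix K A R \<longleftrightarrow>
    R \<in> Units (tensor_power K A 3) \<and>
    (\<exists>(n::nat) x y z.
      (\<forall>i<n. x i \<in> carrier A \<and> y i \<in> carrier A \<and> z i \<in> carrier A) \<and>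
      R = (\<Oplus>\<^bsub>tensor_power K A 3\<^esub> i \<in> {..<n}. tensor K A [x i, y i, z i]) \<and>
      (\<forall>a \<in> carrier A.
        (\<Oplus>\<^bsub>tensor_power K A 3\<^esub> i \<in> {..<n}. tensor K A [x i, y i, a \<otimes>\<^bsub>A\<^esub> z i]) =
        (\<Oplus>\<^bsub>tensor_power K A 3\<^esub> i \<in> {..<n}. tensor K A [x i \<otimes>\<^bsub>A\<^esub> a, y i, z i])) \<and>
      (\<forall>a \<in> carrier A.
        (\<Oplus>\<^bsub>tensor_power K A 3\<^esub> i \<in> {..<n}. tensor K A [a \<otimes>\<^bsub>A\<^esub> x i, y i, z i]) =
        (\<Oplus>\<^bsub>tensor_power K A 3\<^esub> i \<in> {..<n}. tensor K A [x i, y i \<otimes>\<^bsub>A\<^esub> a, z i])) \<and>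
      (\<forall>a \<in> carrier A.
        (\<Oplus>\<^bsub>tensor_power K A 3\<^esub> i \<in> {..<n}. tensor K A [x i, a \<otimes>\<^bsub>A\<^esub> y i, z i]) =
        (\<Oplus>\<^bsub>tensor_power K A 3\<^esub> i \<in> {..<n}. tensor K A [x i, y i, z i \<otimes>\<^bsub>A\<^esub> a])) \<and>
      (\<Oplus>\<^bsub>tensor_power K A 4\<^esub> i \<in> {..<n}. tensor K A [x i, y i, \<one>\<^bsub>A\<^esub>, z i]) =
      (\<Oplus>\<^bsub>tensor_power K A 4\<^esub> i \<in> {..<n}. \<Oplus>\<^bsub>tensor_power K A 4\<^esub> j \<in> {..<n}.
        tensor K A [x j \<otimes>\<^bsub>A\<^esub> x i, y j, z j \<otimes>\<^bsub>A\<^esub> y i, z i]) \<and>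
      (\<Oplus>\<^bsub>tensor_power K A 4\<^esub> i \<in> {..<n}. tensor K A [x i, \<one>\<^bsub>A\<^esub>, y i, z i]) =
      (\<Oplus>\<^bsub>tensor_power K A 4\<^esub> i \<in> {..<n}. \<Oplus>\<^bsub>tensor_power K A 4\<^esub> j \<in> {..<n}.
        tensor K A [x i, y i \<otimes>\<^bsub>A\<^esub> x j, y j, z i \<otimes>\<^bsub>A\<^esub> z j]))"


section \<open>Epimorphisms of rings\<close>

text \<open>
  An epimorphism in the category of unital associative rings is right cancellable against all
  pairs of homomorphisms into all rings.  HOL cannot quantify over types inside a formula, so the
  test rings have their elements in the type \<^typ>\<open>'b list\<close>, where \<^typ>\<open>'b\<close> is the type of the
  elements of the codomain.  By lemma \<open>ring_epi_cancel\<close> below this is no restriction: an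
  epimorphism in this sense is right cancellable against homomorphisms into rings over any type.
\<close>

definition ring_epi ::
  "('a, 'p) ring_scheme \<Rightarrow> ('b, 'm) ring_scheme \<Rightarrow> ('a \<Rightarrow> 'b) \<Rightarrow> bool" where
  "ring_epi K A u \<longleftrightarrow>
    u \<in> ring_hom K A \<and>
    (\<forall>(S :: 'b list ring) f g.
      ring S \<and> f \<in> ring_hom A S \<and> g \<in> ring_hom A S \<and>
      (\<forall>c \<in> carrier K. f (u c) = g (u c)) \<longrightarrow>
      (\<forall>a \<in> carrier A. f a = g a))"

text \<open>
  The images of two homomorphisms generate a subring whose elements are values of finite
  expressions; these expressions can be encoded in \<^typ>\<open>'b list\<close>.
\<close>

datatype 'b expr = ELeft 'b | ERight 'b | EOne | ENeg "'b expr"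
  | EPlus "'b expr" "'b expr" | ETimes "'b expr" "'b expr"

primrec expr_val ::
  "('s, 'n) ring_scheme \<Rightarrow> ('b \<Rightarrow> 's) \<Rightarrow> ('b \<Rightarrow> 's) \<Rightarrow> 'b expr \<Rightarrow> 's" where
  "expr_val S f g (ELeft b) = f b"
| "expr_val S f g (ERight b) = g b"
| "expr_val S f g EOne = \<one>\<^bsub>S\<^esub>"
| "expr_val S f g (ENeg s) = \<ominus>\<^bsub>S\<^esub> expr_val S f g s"
| "expr_val S f g (EPlus s t) = expr_val S f g s \<oplus>\<^bsub>S\<^esub> expr_val S f g t"
| "expr_val S f g (ETimes s t) = expr_val S f g s \<otimes>\<^bsub>S\<^esub> expr_val S f g t"

primrec expr_code :: "('b list \<times> 'b list \<Rightarrow> 'b list) \<Rightarrow> 'b expr \<Rightarrow> 'b list" where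
  "expr_code p (ELeft b) = p (replicate 0 undefined, [b])"
| "expr_code p (ERight b) = p (replicate 1 undefined, [b])"
| "expr_code p EOne = p (replicate 2 undefined, [])"
| "expr_code p (ENeg s) = p (replicate 3 undefined, expr_code p s)"
| "expr_code p (EPlus s t) = p (replicate 4 undefined, p (expr_code p s, expr_code p t))"
| "expr_code p (ETimes s t) = p (replicate 5 undefined, p (expr_code p s, expr_code p t))"

lemma expr_code_inj:
  assumes p: "inj p"
  shows "expr_code p s = expr_code p t \<Longrightarrow> s = t"
proof (induction s arbitrary: t)
  case (ELeft x)
  then show ?case by (cases t) (auto simp: inj_eq[OF p])
next
  case (ERight x)
  then show ?case by (cases t) (auto simp: inj_eq[OF p] dest: arg_cong[of _ _ length])
next
  case EOne
  then show ?case by (cases t) (auto simp: inj_eq[OF p] dest: arg_cong[of _ _ length])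
next
  case (ENeg s)
  then show ?case by (cases t) (auto simp: inj_eq[OF p] dest: arg_cong[of _ _ length])
next
  case (EPlus s1 s2)
  then show ?case by (cases t) (auto simp: inj_eq[OF p] dest: arg_cong[of _ _ length])
next
  case (ETimes s1 s2)
  then show ?case by (cases t) (auto simp: inj_eq[OF p] dest: arg_cong[of _ _ length])
qed

lemma inj_expr_list: "\<exists>h :: 'b expr \<Rightarrow> 'b list. inj h"
proof -
  have "infinite (UNIV :: 'b list set)"
    by (rule infinite_UNIV_listI)
  then have "\<exists>p :: 'b list \<times> 'b list \<Rightarrow> 'b list. bij_betw p (UNIV \<times> UNIV) UNIV"
    using card_of_Times_same_infinite card_of_ordIso by blast
  then obtain p :: "'b list \<times> 'b list \<Rightarrow> 'b list" where "inj p"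
    by (auto simp: bij_betw_def)
  then have "inj (expr_code p)"
    using expr_code_inj by (blast intro: injI)
  then show ?thesis by blast
qed

lemma ring_epi_cancel:
  fixes K :: "('a, 'p) ring_scheme" and A :: "('b, 'm) ring_scheme"
    and S :: "('s, 'n) ring_scheme"
  assumes epi: "ring_epi K A u" and S: "ring S"
    and f: "f \<in> ring_hom A S" and g: "g \<in> ring_hom A S"
    and eq: "\<And>c. c \<in> carrier K \<Longrightarrow> f (u c) = g (u c)"
    and a: "a \<in> carrier A"
  shows "f a = g a"
proof -
  interpret S: ring S by (rule S)
  define W where "W = {s :: 'b expr. set_expr s \<subseteq> carrier A}"
  define D where "D = expr_val S f g ` W"
  have cl: "expr_val S f g s \<in> carrier S" if "s \<in> W" for s
    using that f g unfolding W_def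
    by (induction s) (auto simp: ring_hom_def)
  have "subring D S"
  proof (rule S.subringI)
    show "D \<subseteq> carrier S" using cl by (auto simp: D_def)
    have "EOne \<in> W" by (simp add: W_def)
    then show "\<one>\<^bsub>S\<^esub> \<in> D" unfolding D_def by (metis expr_val.simps(3) imageI)
    show "\<ominus>\<^bsub>S\<^esub> h \<in> D" if "h \<in> D" for h
    proof -
      from that obtain s where "s \<in> W" "h = expr_val S f g s" by (auto simp: D_def)
      then have "ENeg s \<in> W" "\<ominus>\<^bsub>S\<^esub> h = expr_val S f g (ENeg s)" by (auto simp: W_def)
      then show ?thesis unfolding D_def by blast
    qed
    show "h \<otimes>\<^bsub>S\<^esub> h' \<in> D" if "h \<in> D" "h' \<in> D" for h h'
    proof -
      from that obtain s t where "s \<in> W" "h = expr_val S f g s" "t \<in> W" "h' = expr_val S f g t"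
        by (auto simp: D_def)
      then have "ETimes s t \<in> W" "h \<otimes>\<^bsub>S\<^esub> h' = expr_val S f g (ETimes s t)" by (auto simp: W_def)
      then show ?thesis unfolding D_def by blast
    qed
    show "h \<oplus>\<^bsub>S\<^esub> h' \<in> D" if "h \<in> D" "h' \<in> D" for h h'
    proof -
      from that obtain s t where "s \<in> W" "h = expr_val S f g s" "t \<in> W" "h' = expr_val S f g t"
        by (auto simp: D_def)
      then have "EPlus s t \<in> W" "h \<oplus>\<^bsub>S\<^esub> h' = expr_val S f g (EPlus s t)" by (auto simp: W_def)
      then show ?thesis unfolding D_def by blast
    qed
  qed
  then interpret D: ring "S\<lparr>carrier := D\<rparr>"
    by (rule S.subring_is_ring)
  obtain h :: "'b expr \<Rightarrow> 'b list" where h: "inj h"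
    using inj_expr_list by blast
  define e where "e = h \<circ> inv_into W (expr_val S f g)"
  have e: "inj_on e D"
    unfolding e_def
    by (rule comp_inj_on) (use h in \<open>auto simp: D_def inj_on_inv_into intro: inj_on_subset\<close>)
  define S' where "S' = image_ring e (S\<lparr>carrier := D\<rparr>)"
  have S': "ring S'"
    unfolding S'_def by (rule D.inj_imp_image_ring_is_ring) (simp add: e)
  have iso: "e \<in> ring_iso (S\<lparr>carrier := D\<rparr>) S'"
    unfolding S'_def by (rule inj_imp_image_ring_iso) (simp add: e)
  have fD: "f b \<in> D" and gD: "g b \<in> D" if "b \<in> carrier A" for b
  proof -
    from that have "ELeft b \<in> W" "ERight b \<in> W" by (auto simp: W_def)
    then have "expr_val S f g (ELeft b) \<in> D" "expr_val S f g (ERight b) \<in> D"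
      unfolding D_def by blast+
    then show "f b \<in> D" "g b \<in> D" by simp_all
  qed
  have "e \<circ> f \<in> ring_hom A S'"
    by (rule ring_hom_trans[of _ _ "S\<lparr>carrier := D\<rparr>"])
      (use f fD iso in \<open>auto simp: ring_hom_def ring_iso_def\<close>)
  moreover have "e \<circ> g \<in> ring_hom A S'"
    by (rule ring_hom_trans[of _ _ "S\<lparr>carrier := D\<rparr>"])
      (use g gD iso in \<open>auto simp: ring_hom_def ring_iso_def\<close>)
  moreover have "\<forall>c \<in> carrier K. (e \<circ> f) (u c) = (e \<circ> g) (u c)"
    using eq by simp
  ultimately have "(e \<circ> f) a = (e \<circ> g) a"
    using epi S' a unfolding ring_epi_def by blast
  then show ?thesis
    using e fD[OF a] gD[OF a] by (simp add: inj_on_eq_iff)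
qed

end

theory Submission
  imports Defs "HOL-Algebra.Free_Abelian_Groups"
begin

text \<open>
  Write \<open>R = x \<otimes> y \<otimes> z\<close> for a monomial canonical R-matrix.  The last defining identity,
  contracted along \<open>a \<otimes> b \<otimes> c \<otimes> d \<mapsto> ba \<otimes> c \<otimes> d\<close>, becomes \<open>R = (yx \<otimes> 1 \<otimes> z)R\<close>, whence
  \<open>yx \<otimes> 1 \<otimes> z = 1\<close> (lemma \<open>canonical_monomial_contraction\<close>).  The second identity at \<open>a = y\<close> is
  \<open>yx \<otimes> y \<otimes> z = x \<otimes> yy \<otimes> z\<close>, that is, \<open>1 \<otimes> y \<otimes> 1 = R(1 \<otimes> y \<otimes> 1)\<close>.  Since \<open>R\<close> is invertible,
  \<open>1 \<otimes> y \<otimes> 1\<close> can be cancelled on the right, and \<open>R = 1\<close> (lemma \<open>canonical_monomial_eq_one\<close>).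

  For \<open>R = 1 \<otimes> 1 \<otimes> 1\<close> the definition only says that each \<open>a\<close> in \<open>A\<close> gives the same tensor in all
  three slots.  An epimorphism \<open>K \<rightarrow> A\<close> forces this, because the three embeddings of \<open>A\<close> into
  \<open>A \<otimes> A \<otimes> A\<close> are ring homomorphisms that agree on the scalars.  Conversely, two homomorphisms \<open>f\<close>
  and \<open>g\<close> from \<open>A\<close> that agree on the scalars factor through
  \<open>a \<otimes> b \<otimes> c \<mapsto> f(a)g(b)g(c)\<close> and are therefore equal (lemma \<open>canonical_one_iff_ring_epi\<close>).

  If \<open>A\<close> is commutative, an invertible \<open>R\<close> cancels from the second and third identities, so that
  again the slots are interchangeable.  Every tensor is then of the form \<open>a \<otimes> 1 \<otimes> 1\<close>; in
  particular \<open>R\<close> is a monomial, and the result on monomials applies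
  (lemma \<open>canonical_commutative_monomial\<close>).

  All of this rests on two facts about the tensor power as a quotient of a free abelian group: it
  is a ring with slotwise product (lemma \<open>ring_tensor_power\<close>), and balanced maps on tuples factor
  through it (lemma \<open>balanced_lift\<close>).
\<close>

section \<open>Preliminaries\<close>

lemma tuples_iff:
  "t \<in> tuples A n \<longleftrightarrow> length t = n \<and> (\<forall>i<n. t ! i \<in> carrier A)"
  by (auto simp: tuples_def in_set_conv_nth subset_iff)

lemma tuples_update: "\<lbrakk>t \<in> tuples A n; x \<in> carrier A\<rbrakk> \<Longrightarrow> t[i := x] \<in> tuples A n"
  by (cases "i < n") (auto simp: tuples_iff nth_list_update)

lemma map2_update:
  assumes "length s = length t"
  shows "map2 f s (t[i := x]) = (map2 f s t)[i := f (s ! i) x]"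
    and "map2 f (s[i := x]) t = (map2 f s t)[i := f x (t ! i)]"
  using assms by (cases "i < length t"; auto intro!: nth_equalityI simp: nth_list_update)+

lemma frag_extend_fun_diff: "frag_extend (\<lambda>s. p s - q s) f = frag_extend p f - frag_extend q f"
  using subset_UNIV by (induction f rule: frag_induction) (auto simp: frag_extend_diff)

lemma frag_extend_fun_add: "frag_extend (\<lambda>s. p s + q s) f = frag_extend p f + frag_extend q f"
  using subset_UNIV by (induction f rule: frag_induction) (auto simp: frag_extend_diff)

lemma frag_extend_fun_zero: "frag_extend (\<lambda>s. 0) f = 0"
  using subset_UNIV by (induction f rule: frag_induction) (auto simp: frag_extend_diff)

text \<open>
  This is stated for additive homomorphisms because the maps applied to decompositions
  \<open>R = \<Sum>\<^sub>i x\<^sub>i \<otimes> y\<^sub>i \<otimes> z\<^sub>i\<close> below contract tensor slots and need not respect multiplication.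
\<close>

lemma additive_hom_finsum:
  assumes G: "abelian_group G" and H: "abelian_group H"
    and h: "h \<in> hom (add_monoid G) (add_monoid H)"
    and I: "finite I" and f: "f \<in> I \<rightarrow> carrier G"
  shows "h (\<Oplus>\<^bsub>G\<^esub>i\<in>I. f i) = (\<Oplus>\<^bsub>H\<^esub>i\<in>I. h (f i))"
proof -
  interpret G: abelian_group G by (rule G)
  interpret H: abelian_group H by (rule H)
  interpret h: group_hom "add_monoid G" "add_monoid H" h
    using h by (simp add: group_hom_def group_hom_axioms_def G.a_group H.a_group)
  have cl: "h x \<in> carrier H" if "x \<in> carrier G" for x using h.hom_closed that by simp
  show ?thesis using I f
  proof (induction I)
    case empty
    show ?case using h.hom_one by simp
  next
    case (insert i I)
    have "h (f i \<oplus>\<^bsub>G\<^esub> (\<Oplus>\<^bsub>G\<^esub>i\<in>I. f i)) = h (f i) \<oplus>\<^bsub>H\<^esub> h (\<Oplus>\<^bsub>G\<^esub>i\<in>I. f i)"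
      using insert h.hom_mult[of "f i" "\<Oplus>\<^bsub>G\<^esub>i\<in>I. f i"] by (simp add: G.finsum_closed Pi_def)
    then show ?case using insert by (simp add: Pi_def cl)
  qed
qed

section \<open>The tensor power is a ring\<close>

context assoc_algebra
begin

lemma map2_mult_tuples:
  "\<lbrakk>s \<in> tuples A n; t \<in> tuples A n\<rbrakk> \<Longrightarrow> map2 (\<otimes>\<^bsub>A\<^esub>) s t \<in> tuples A n"
  by (auto simp: tuples_iff)

text \<open>
  The product is biadditive by construction, so each ring law for it reduces, one argument at a
  time, to the same law for tuples, where it holds slot by slot.
\<close>

lemma ring_free_tuple_ring: "ring (free_tuple_ring A n)"
proof -
  define T where "T = tuples A n"
  let ?F = "free_tuple_ring A n"
  have car: "carrier ?F = {f. Poly_Mapping.keys f \<subseteq> T}"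
    by (simp add: free_tuple_ring_def T_def)
  have distl: "(f + g) \<otimes>\<^bsub>?F\<^esub> h = f \<otimes>\<^bsub>?F\<^esub> h + g \<otimes>\<^bsub>?F\<^esub> h"
    and distr: "h \<otimes>\<^bsub>?F\<^esub> (f + g) = h \<otimes>\<^bsub>?F\<^esub> f + h \<otimes>\<^bsub>?F\<^esub> g"
    and diffl: "(f - g) \<otimes>\<^bsub>?F\<^esub> h = f \<otimes>\<^bsub>?F\<^esub> h - g \<otimes>\<^bsub>?F\<^esub> h"
    and diffr: "h \<otimes>\<^bsub>?F\<^esub> (f - g) = h \<otimes>\<^bsub>?F\<^esub> f - h \<otimes>\<^bsub>?F\<^esub> g"
    and zl: "0 \<otimes>\<^bsub>?F\<^esub> h = 0" and zr: "h \<otimes>\<^bsub>?F\<^esub> 0 = 0"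
    and mul: "frag_of s \<otimes>\<^bsub>?F\<^esub> frag_of t = frag_of (map2 (\<otimes>\<^bsub>A\<^esub>) s t)" for f g h s t
    by (simp_all add: free_tuple_ring_def frag_extend_add frag_extend_fun_add frag_extend_diff
        frag_extend_fun_diff frag_extend_fun_zero)
  have keys_diff: "Poly_Mapping.keys (a - b) \<subseteq> T"
    if "Poly_Mapping.keys a \<subseteq> T" "Poly_Mapping.keys b \<subseteq> T" for a b :: "'a list \<Rightarrow>\<^sub>0 int"
    using that keys_diff[of a b] by blast
  have cl1: "Poly_Mapping.keys (frag_of s \<otimes>\<^bsub>?F\<^esub> g) \<subseteq> T"
    if "s \<in> T" "Poly_Mapping.keys g \<subseteq> T" for s g
    using that(2) by (induction g rule: frag_induction)
      (use that(1) map2_mult_tuples keys_diff in \<open>auto simp: zr mul diffr T_def\<close>)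
  have cl: "Poly_Mapping.keys (f \<otimes>\<^bsub>?F\<^esub> g) \<subseteq> T"
    if "Poly_Mapping.keys f \<subseteq> T" "Poly_Mapping.keys g \<subseteq> T" for f g
    using that(1) by (induction f rule: frag_induction)
      (use that(2) cl1 keys_diff in \<open>auto simp: zl diffl\<close>)
  have asT: "map2 (\<otimes>\<^bsub>A\<^esub>) (map2 (\<otimes>\<^bsub>A\<^esub>) s t) u = map2 (\<otimes>\<^bsub>A\<^esub>) s (map2 (\<otimes>\<^bsub>A\<^esub>) t u)"
    if "s \<in> T" "t \<in> T" "u \<in> T" for s t u
    using that by (auto simp: T_def tuples_iff A.m_assoc intro!: nth_equalityI)
  have as1: "(frag_of s \<otimes>\<^bsub>?F\<^esub> frag_of t) \<otimes>\<^bsub>?F\<^esub> h = frag_of s \<otimes>\<^bsub>?F\<^esub> (frag_of t \<otimes>\<^bsub>?F\<^esub> h)"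
    if "s \<in> T" "t \<in> T" "Poly_Mapping.keys h \<subseteq> T" for s t h
    using that(3) by (induction h rule: frag_induction)
     (use that asT in \<open>auto simp: zr mul diffr\<close>)
  have as2: "(frag_of s \<otimes>\<^bsub>?F\<^esub> g) \<otimes>\<^bsub>?F\<^esub> h = frag_of s \<otimes>\<^bsub>?F\<^esub> (g \<otimes>\<^bsub>?F\<^esub> h)"
    if "s \<in> T" "Poly_Mapping.keys g \<subseteq> T" "Poly_Mapping.keys h \<subseteq> T" for s g h
    using that(2) by (induction g rule: frag_induction)
     (use that as1 in \<open>auto simp: zr zl diffr diffl\<close>)
  have as: "(f \<otimes>\<^bsub>?F\<^esub> g) \<otimes>\<^bsub>?F\<^esub> h = f \<otimes>\<^bsub>?F\<^esub> (g \<otimes>\<^bsub>?F\<^esub> h)"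
    if "Poly_Mapping.keys f \<subseteq> T" "Poly_Mapping.keys g \<subseteq> T" "Poly_Mapping.keys h \<subseteq> T" for f g h
    using that(1) by (induction f rule: frag_induction)
     (use that as2 in \<open>auto simp: zl diffl\<close>)
  have oneF: "\<one>\<^bsub>?F\<^esub> = frag_of (replicate n \<one>\<^bsub>A\<^esub>)"
    by (simp add: free_tuple_ring_def)
  have one_T: "replicate n \<one>\<^bsub>A\<^esub> \<in> T" by (simp add: T_def tuples_iff)
  have oneT: "map2 (\<otimes>\<^bsub>A\<^esub>) (replicate n \<one>\<^bsub>A\<^esub>) t = t" "map2 (\<otimes>\<^bsub>A\<^esub>) t (replicate n \<one>\<^bsub>A\<^esub>) = t"
    if "t \<in> T" for t
    using that by (auto simp: T_def tuples_iff intro!: nth_equalityI)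
  have l1: "\<one>\<^bsub>?F\<^esub> \<otimes>\<^bsub>?F\<^esub> f = f" if "Poly_Mapping.keys f \<subseteq> T" for f
    using that by (induction f rule: frag_induction) (auto simp: oneF zr mul diffr oneT)
  have r1: "f \<otimes>\<^bsub>?F\<^esub> \<one>\<^bsub>?F\<^esub> = f" if "Poly_Mapping.keys f \<subseteq> T" for f
    using that by (induction f rule: frag_induction) (auto simp: oneF zl mul diffl oneT)
  have add: "x \<oplus>\<^bsub>?F\<^esub> y = x + y" "\<zero>\<^bsub>?F\<^esub> = 0" for x y by (simp_all add: free_tuple_ring_def)
  show ?thesis
  proof (rule ringI)
    show "abelian_group ?F"
    proof (rule abelian_groupI)
      show "\<exists>y\<in>carrier ?F. y \<oplus>\<^bsub>?F\<^esub> x = \<zero>\<^bsub>?F\<^esub>" if "x \<in> carrier ?F" for x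
        using that by (intro bexI[of _ "- x"]) (auto simp: add car)
    qed (use keys_add in \<open>fastforce simp: car add add.assoc add.commute\<close>)+
    show "monoid ?F"
      by (rule monoidI) (use cl as l1 r1 one_T in \<open>auto simp: car oneF\<close>)
  qed (simp_all add: add distl distr)
qed

lemma free_tuple_ring_simps:
  "f \<oplus>\<^bsub>free_tuple_ring A n\<^esub> g = f + g"
  "\<zero>\<^bsub>free_tuple_ring A n\<^esub> = 0"
  "\<one>\<^bsub>free_tuple_ring A n\<^esub> = frag_of (replicate n \<one>\<^bsub>A\<^esub>)"
  "frag_of s \<otimes>\<^bsub>free_tuple_ring A n\<^esub> frag_of t = frag_of (map2 (\<otimes>\<^bsub>A\<^esub>) s t)"
  "f \<in> carrier (free_tuple_ring A n) \<longleftrightarrow> Poly_Mapping.keys f \<subseteq> tuples A n"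
  by (simp_all add: free_tuple_ring_def)

lemma free_tuple_ring_minus:
  assumes "f \<in> carrier (free_tuple_ring A n)"
  shows "\<ominus>\<^bsub>free_tuple_ring A n\<^esub> f = - f"
proof -
  interpret F: ring "free_tuple_ring A n" by (rule ring_free_tuple_ring)
  show ?thesis
    by (rule F.minus_equality) (use assms in \<open>auto simp: free_tuple_ring_simps\<close>)
qed

lemma free_tuple_ring_diff_distrib:
  "(f - g) \<otimes>\<^bsub>free_tuple_ring A n\<^esub> h = f \<otimes>\<^bsub>free_tuple_ring A n\<^esub> h - g \<otimes>\<^bsub>free_tuple_ring A n\<^esub> h"
  "h \<otimes>\<^bsub>free_tuple_ring A n\<^esub> (f - g) = h \<otimes>\<^bsub>free_tuple_ring A n\<^esub> f - h \<otimes>\<^bsub>free_tuple_ring A n\<^esub> g"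
  by (simp_all add: free_tuple_ring_def frag_extend_diff frag_extend_fun_diff)

lemma tensor_relators_carrier: "tensor_relators K A n \<subseteq> carrier (free_tuple_ring A n)"
proof -
  have d: "Poly_Mapping.keys (a - b) \<subseteq> T" if "Poly_Mapping.keys a \<subseteq> T" "Poly_Mapping.keys b \<subseteq> T"
    for a b :: "'a list \<Rightarrow>\<^sub>0 int" and T
    using that keys_diff[of a b] by blast
  have f: "Poly_Mapping.keys (frag_of (t[i := x])) \<subseteq> tuples A n"
    if "t \<in> tuples A n" "x \<in> carrier A" for t i x
    using that by (simp add: tuples_update)
  have e: "t ! i \<in> carrier A" if "t \<in> tuples A n" "i < n" for t i
    using that by (simp add: tuples_iff)
  show ?thesis
  proof
    fix r assume "r \<in> tensor_relators K A n"
    then have "Poly_Mapping.keys r \<subseteq> tuples A n"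
      unfolding tensor_relators_def
    proof (elim UnE CollectE exE conjE)
      fix t i x y
      assume r: "r = frag_of (t[i := x \<oplus>\<^bsub>A\<^esub> y]) - frag_of (t[i := x]) - frag_of (t[i := y])"
        and "t \<in> tuples A n" "x \<in> carrier A" "y \<in> carrier A"
      then show ?thesis unfolding r by (intro d f M.a_closed)
    next
      fix t i j c
      assume r: "r = frag_of (t[i := c \<odot>\<^bsub>A\<^esub> (t ! i)]) - frag_of (t[j := c \<odot>\<^bsub>A\<^esub> (t ! j)])"
        and "t \<in> tuples A n" "i < n" "j < n" "c \<in> carrier K"
      then show ?thesis unfolding r by (intro d f smult_closed e)
    qed
    then show "r \<in> carrier (free_tuple_ring A n)" by (simp add: free_tuple_ring_simps)
  qed
qed

lemma tensor_null_add_subgroup: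
  "subgroup (tensor_null K A n) (add_monoid (free_tuple_ring A n))"
proof -
  interpret F: ring "free_tuple_ring A n" by (rule ring_free_tuple_ring)
  show ?thesis unfolding tensor_null_def
    by (rule F.add.generate_is_subgroup) (use tensor_relators_carrier in simp)
qed

text \<open>
  Multiplying a relator by a tuple gives a relator of the same kind: an additivity relator stays
  one by distributivity in the slot concerned, and a scalar relator stays one because scalars pass
  through products from both sides.  This is what makes the additive span of the relators a
  two-sided ideal.
\<close>

lemma tensor_relators_mult_frag_of:
  assumes r: "r \<in> tensor_relators K A n" and s: "s \<in> tuples A n"
  shows "frag_of s \<otimes>\<^bsub>free_tuple_ring A n\<^esub> r \<in> tensor_relators K A n"
    and "r \<otimes>\<^bsub>free_tuple_ring A n\<^esub> frag_of s \<in> tensor_relators K A n"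
proof -
  let ?m = "map2 (\<otimes>\<^bsub>A\<^esub>)"
  note simps = free_tuple_ring_diff_distrib free_tuple_ring_simps(4)
  have ls: "length s = n" and sc: "\<And>i. i < n \<Longrightarrow> s ! i \<in> carrier A" using s by (auto simp: tuples_iff)
  from r consider (add) t i x y where
      "r = frag_of (t[i := x \<oplus>\<^bsub>A\<^esub> y]) - frag_of (t[i := x]) - frag_of (t[i := y])"
      "t \<in> tuples A n" "i < n" "x \<in> carrier A" "y \<in> carrier A"
    | (scalar) t i j c where
      "r = frag_of (t[i := c \<odot>\<^bsub>A\<^esub> (t ! i)]) - frag_of (t[j := c \<odot>\<^bsub>A\<^esub> (t ! j)])"
      "t \<in> tuples A n" "i < n" "j < n" "c \<in> carrier K"
    unfolding tensor_relators_def by blast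
  then have "frag_of s \<otimes>\<^bsub>free_tuple_ring A n\<^esub> r \<in> tensor_relators K A n \<and>
    r \<otimes>\<^bsub>free_tuple_ring A n\<^esub> frag_of s \<in> tensor_relators K A n"
  proof cases
    case add
    have lt: "length t = n" using add by (simp add: tuples_iff)
    have "frag_of s \<otimes>\<^bsub>free_tuple_ring A n\<^esub> r =
      frag_of ((?m s t)[i := s ! i \<otimes>\<^bsub>A\<^esub> x \<oplus>\<^bsub>A\<^esub> s ! i \<otimes>\<^bsub>A\<^esub> y])
      - frag_of ((?m s t)[i := s ! i \<otimes>\<^bsub>A\<^esub> x]) - frag_of ((?m s t)[i := s ! i \<otimes>\<^bsub>A\<^esub> y])"
      using add sc by (simp add: simps map2_update ls lt A.r_distr)
    moreover have "r \<otimes>\<^bsub>free_tuple_ring A n\<^esub> frag_of s =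
      frag_of ((?m t s)[i := x \<otimes>\<^bsub>A\<^esub> s ! i \<oplus>\<^bsub>A\<^esub> y \<otimes>\<^bsub>A\<^esub> s ! i])
      - frag_of ((?m t s)[i := x \<otimes>\<^bsub>A\<^esub> s ! i]) - frag_of ((?m t s)[i := y \<otimes>\<^bsub>A\<^esub> s ! i])"
      using add sc by (simp add: simps map2_update ls lt A.l_distr)
    moreover have "?m s t \<in> tuples A n" "?m t s \<in> tuples A n"
      using add s by (auto intro: map2_mult_tuples)
    ultimately show ?thesis
      using add sc unfolding tensor_relators_def by (blast intro: A.m_closed)
  next
    case scalar
    have lt: "length t = n" and tc: "\<And>i. i < n \<Longrightarrow> t ! i \<in> carrier A"
      using scalar by (auto simp: tuples_iff)
    have "frag_of s \<otimes>\<^bsub>free_tuple_ring A n\<^esub> r =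
      frag_of ((?m s t)[i := c \<odot>\<^bsub>A\<^esub> (?m s t ! i)]) - frag_of ((?m s t)[j := c \<odot>\<^bsub>A\<^esub> (?m s t ! j)])"
      using scalar sc tc by (simp add: simps map2_update ls lt smult_mult_right)
    moreover have "r \<otimes>\<^bsub>free_tuple_ring A n\<^esub> frag_of s =
      frag_of ((?m t s)[i := c \<odot>\<^bsub>A\<^esub> (?m t s ! i)]) - frag_of ((?m t s)[j := c \<odot>\<^bsub>A\<^esub> (?m t s ! j)])"
      using scalar sc tc by (simp add: simps map2_update ls lt smult_mult_left)
    moreover have "?m s t \<in> tuples A n" "?m t s \<in> tuples A n"
      using scalar s by (auto intro: map2_mult_tuples)
    ultimately show ?thesis
      using scalar unfolding tensor_relators_def by blast
  qed
  then show "frag_of s \<otimes>\<^bsub>free_tuple_ring A n\<^esub> r \<in> tensor_relators K A n"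
    and "r \<otimes>\<^bsub>free_tuple_ring A n\<^esub> frag_of s \<in> tensor_relators K A n" by auto
qed

lemma tensor_null_ideal: "ideal (tensor_null K A n) (free_tuple_ring A n)"
proof -
  let ?F = "free_tuple_ring A n" and ?N = "tensor_null K A n"
  interpret F: ring ?F by (rule ring_free_tuple_ring)
  interpret N: additive_subgroup ?N ?F
    by (rule additive_subgroupI) (rule tensor_null_add_subgroup)
  have rel: "r \<in> carrier ?F" if "r \<in> tensor_relators K A n" for r
    using that tensor_relators_carrier by blast
  have sub: "a - b \<in> ?N" if "a \<in> ?N" "b \<in> ?N" for a b
  proof -
    have "a \<oplus>\<^bsub>?F\<^esub> (\<ominus>\<^bsub>?F\<^esub> b) \<in> ?N"
      using that by (intro N.a_closed N.a_inv_closed)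
    then show ?thesis
      using free_tuple_ring_minus[OF N.a_Hcarr[OF that(2)]] by (simp add: free_tuple_ring_simps)
  qed
  have mult_relator: "r \<otimes>\<^bsub>?F\<^esub> f \<in> ?N \<and> f \<otimes>\<^bsub>?F\<^esub> r \<in> ?N"
    if r: "r \<in> tensor_relators K A n" and f: "Poly_Mapping.keys f \<subseteq> tuples A n" for r f
    using f
  proof (induction f rule: frag_induction)
    case zero
    then show ?case
      using r rel N.zero_closed F.l_null[of r] F.r_null[of r] by (simp add: free_tuple_ring_simps)
  next
    case (one s)
    then show ?case
      using tensor_relators_mult_frag_of[OF r] generate.incl unfolding tensor_null_def by metis
  next
    case (diff a b)
    then show ?case by (simp add: free_tuple_ring_diff_distrib sub)
  qed
  have mult: "u \<otimes>\<^bsub>?F\<^esub> f \<in> ?N \<and> f \<otimes>\<^bsub>?F\<^esub> u \<in> ?N" if u: "u \<in> ?N" and f: "f \<in> carrier ?F" for u f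
    using u unfolding tensor_null_def
  proof (induction u rule: generate.induct)
    case one
    then show ?case using f N.zero_closed by (simp add: tensor_null_def)
  next
    case (incl r)
    show ?case
      using mult_relator[OF incl, of f, unfolded tensor_null_def] f
      by (simp only: free_tuple_ring_simps(5))
  next
    case (inv r)
    have inv_eq: "inv\<^bsub>add_monoid ?F\<^esub> r = \<ominus>\<^bsub>?F\<^esub> r" by (simp add: a_inv_def)
    have "\<ominus>\<^bsub>?F\<^esub> (r \<otimes>\<^bsub>?F\<^esub> f) \<in> ?N" "\<ominus>\<^bsub>?F\<^esub> (f \<otimes>\<^bsub>?F\<^esub> r) \<in> ?N"
      using mult_relator[OF inv(1), of f] f N.a_inv_closed by (simp_all add: free_tuple_ring_simps)
    then show ?case using f rel[OF inv(1)] unfolding inv_eq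
      by (simp add: F.l_minus F.r_minus tensor_null_def)
  next
    case (eng u v)
    have "u \<in> carrier ?F" "v \<in> carrier ?F"
      using eng(1,2) N.a_Hcarr by (simp_all add: tensor_null_def)
    then show ?case using eng f N.a_closed
      by (simp add: F.l_distr F.r_distr tensor_null_def)
  qed
  show ?thesis
    by (rule idealI) (use mult F.ring_axioms tensor_null_add_subgroup in auto)
qed

lemma ring_tensor_power: "ring (tensor_power K A n)"
  unfolding tensor_power_def by (rule ideal.quotient_is_ring) (rule tensor_null_ideal)

end

section \<open>The universal property of tensor powers\<close>

text \<open>
  These are the multilinear maps without a scalar action on the target: all that survives of
  \<open>K\<close>-linearity when \<open>G\<close> is merely an additive group is that a scalar may be moved from one slot
  to another.  Taking such targets is what allows a ring with two homomorphisms from \<open>A\<close> that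
  agree on \<open>K\<close> to be a target.
\<close>

definition balanced ::
  "('k, 'p) ring_scheme \<Rightarrow> ('k, 'a, 'm) module_scheme \<Rightarrow> nat \<Rightarrow> ('g, 'q) ring_scheme \<Rightarrow>
    ('a list \<Rightarrow> 'g) \<Rightarrow> bool" where
  "balanced K A n G F \<longleftrightarrow>
    F \<in> tuples A n \<rightarrow> carrier G \<and>
    (\<forall>t \<in> tuples A n. \<forall>i<n. \<forall>x \<in> carrier A. \<forall>y \<in> carrier A.
      F (t[i := x \<oplus>\<^bsub>A\<^esub> y]) = F (t[i := x]) \<oplus>\<^bsub>G\<^esub> F (t[i := y])) \<and>
    (\<forall>t \<in> tuples A n. \<forall>i<n. \<forall>j<n. \<forall>c \<in> carrier K.
      F (t[i := c \<odot>\<^bsub>A\<^esub> (t ! i)]) = F (t[j := c \<odot>\<^bsub>A\<^esub> (t ! j)]))"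

context assoc_algebra
begin

lemma tensor_closed:
  assumes "t \<in> tuples A n"
  shows "tensor K A t \<in> carrier (tensor_power K A n)"
proof -
  have "length t = n" "frag_of t \<in> carrier (free_tuple_ring A n)"
    using assms by (simp_all add: tuples_iff free_tuple_ring_simps)
  then show ?thesis
    by (auto simp: tensor_def tensor_power_def FactRing_def A_RCOSETS_def')
qed

lemma tensor_mult:
  assumes "s \<in> tuples A n" "t \<in> tuples A n"
  shows "tensor K A s \<otimes>\<^bsub>tensor_power K A n\<^esub> tensor K A t = tensor K A (map2 (\<otimes>\<^bsub>A\<^esub>) s t)"
proof -
  have "length s = n" "length t = n"
    "frag_of s \<in> carrier (free_tuple_ring A n)" "frag_of t \<in> carrier (free_tuple_ring A n)"
    using assms by (simp_all add: tuples_iff free_tuple_ring_simps)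
  then show ?thesis
    using ideal.rcoset_mult_add[OF tensor_null_ideal, of "frag_of s" n "frag_of t"]
    by (simp add: tensor_def tensor_power_def FactRing_def free_tuple_ring_simps)
qed

lemma tensor_one: "\<one>\<^bsub>tensor_power K A n\<^esub> = tensor K A (replicate n \<one>\<^bsub>A\<^esub>)"
  by (simp add: tensor_def tensor_power_def FactRing_def free_tuple_ring_simps)

lemma tensor_null_coset_eq:
  assumes "f \<in> carrier (free_tuple_ring A n)" "g \<in> carrier (free_tuple_ring A n)"
    and "f - g \<in> tensor_null K A n"
  shows "tensor_null K A n +>\<^bsub>free_tuple_ring A n\<^esub> f = tensor_null K A n +>\<^bsub>free_tuple_ring A n\<^esub> g"
proof -
  interpret N: ideal "tensor_null K A n" "free_tuple_ring A n" by (rule tensor_null_ideal)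
  have "f \<in> tensor_null K A n +>\<^bsub>free_tuple_ring A n\<^esub> g"
    unfolding a_r_coset_def' using assms(3)
    by (auto simp: free_tuple_ring_simps intro!: bexI[of _ "f - g"])
  then show ?thesis
    using N.a_repr_independence[OF _ assms(2) tensor_null_add_subgroup] by simp
qed

lemma balanced_tensor: "balanced K A n (tensor_power K A n) (tensor K A)"
proof -
  let ?F = "free_tuple_ring A n"
  interpret N: ideal "tensor_null K A n" ?F by (rule tensor_null_ideal)
  have fr: "frag_of t \<in> carrier ?F" if "t \<in> tuples A n" for t
    using that by (simp add: free_tuple_ring_simps)
  have len: "length t = n" if "t \<in> tuples A n" for t using that by (simp add: tuples_iff)
  have rel: "r \<in> tensor_null K A n" if "r \<in> tensor_relators K A n" for r
    using that by (simp add: tensor_null_def generate.incl)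
  have plus: "tensor K A (t[i := x \<oplus>\<^bsub>A\<^esub> y]) =
      tensor K A (t[i := x]) \<oplus>\<^bsub>tensor_power K A n\<^esub> tensor K A (t[i := y])"
    if "t \<in> tuples A n" "i < n" "x \<in> carrier A" "y \<in> carrier A" for t i x y
  proof -
    have T: "t[i := x \<oplus>\<^bsub>A\<^esub> y] \<in> tuples A n" "t[i := x] \<in> tuples A n" "t[i := y] \<in> tuples A n"
      using that by (auto intro!: tuples_update)
    have "frag_of (t[i := x \<oplus>\<^bsub>A\<^esub> y]) - frag_of (t[i := x]) - frag_of (t[i := y]) \<in> tensor_null K A n"
      by (rule rel) (use that in \<open>unfold tensor_relators_def, blast\<close>)
    then have "tensor_null K A n +>\<^bsub>?F\<^esub> frag_of (t[i := x \<oplus>\<^bsub>A\<^esub> y]) =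
      tensor_null K A n +>\<^bsub>?F\<^esub> (frag_of (t[i := x]) \<oplus>\<^bsub>?F\<^esub> frag_of (t[i := y]))"
      using T fr by (intro tensor_null_coset_eq N.a_closed)
        (auto simp: free_tuple_ring_simps diff_diff_eq)
    also have "\<dots> = (tensor_null K A n +>\<^bsub>?F\<^esub> frag_of (t[i := x])) <+>\<^bsub>?F\<^esub>
       (tensor_null K A n +>\<^bsub>?F\<^esub> frag_of (t[i := y]))"
      using T fr by (simp add: N.a_rcos_sum)
    finally show ?thesis
      using len[OF that(1)] by (simp add: tensor_def tensor_power_def FactRing_def)
  qed
  have scal: "tensor K A (t[i := c \<odot>\<^bsub>A\<^esub> (t ! i)]) = tensor K A (t[j := c \<odot>\<^bsub>A\<^esub> (t ! j)])"
    if "t \<in> tuples A n" "i < n" "j < n" "c \<in> carrier K" for t i j c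
  proof -
    have T: "t[i := c \<odot>\<^bsub>A\<^esub> (t ! i)] \<in> tuples A n" if "i < n" for i
      using that \<open>t \<in> tuples A n\<close> \<open>c \<in> carrier K\<close>
      by (intro tuples_update) (auto simp: tuples_iff)
    have "frag_of (t[i := c \<odot>\<^bsub>A\<^esub> (t ! i)]) - frag_of (t[j := c \<odot>\<^bsub>A\<^esub> (t ! j)]) \<in> tensor_null K A n"
      by (rule rel) (use that in \<open>unfold tensor_relators_def, blast\<close>)
    then show ?thesis
      using len[OF that(1)] T fr that by (simp add: tensor_def tensor_null_coset_eq)
  qed
  show ?thesis
    unfolding balanced_def using plus scal tensor_closed by blast
qed

text \<open>
  A balanced map extends to the free abelian group on the tuples, and that extension kills the
  relators, hence it factors through the quotient.
\<close>

lemma balanced_lift: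
  assumes G: "abelian_group G" and F: "balanced K A n G F"
  obtains h where "h \<in> hom (add_monoid (tensor_power K A n)) (add_monoid G)"
    and "\<And>t. t \<in> tuples A n \<Longrightarrow> h (tensor K A t) = F t"
proof -
  let ?R = "free_tuple_ring A n" and ?N = "tensor_null K A n"
  interpret G: abelian_group G by (rule G)
  interpret N: ideal ?N ?R by (rule tensor_null_ideal)
  have Fc: "F t \<in> carrier G" if "t \<in> tuples A n" for t using F that by (auto simp: balanced_def)
  have "F ` tuples A n \<subseteq> carrier (add_monoid G)" using Fc by auto
  then obtain h where h: "h \<in> hom (free_Abelian_group (tuples A n)) (add_monoid G)"
    and hF: "\<And>t. t \<in> tuples A n \<Longrightarrow> h (frag_of t) = F t"
    using comm_group.free_Abelian_group_universal[OF G.a_comm_group] by metis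
  have "h \<in> hom (add_monoid ?R) (add_monoid G)"
    using h by (simp add: hom_def free_tuple_ring_def free_Abelian_group_def)
  then interpret h: group_hom "add_monoid ?R" "add_monoid G" h
    by (intro group_hom.intro group_hom_axioms.intro G.a_group
        abelian_group.a_group[OF ring.is_abelian_group[OF ring_free_tuple_ring]])
  have h_car: "h f \<in> carrier G" if "f \<in> carrier ?R" for f using h.hom_closed that by simp
  have h_diff: "h (f - g) = h f \<ominus>\<^bsub>G\<^esub> h g" if "f \<in> carrier ?R" "g \<in> carrier ?R" for f g
  proof -
    have "h (\<ominus>\<^bsub>?R\<^esub> g) = \<ominus>\<^bsub>G\<^esub> h g"
      using h.hom_inv[of g] that by (simp add: a_inv_def)
    moreover have "\<ominus>\<^bsub>?R\<^esub> g \<in> carrier ?R" using that by simp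
    ultimately have "h (f \<oplus>\<^bsub>?R\<^esub> (\<ominus>\<^bsub>?R\<^esub> g)) = h f \<oplus>\<^bsub>G\<^esub> (\<ominus>\<^bsub>G\<^esub> h g)"
      using h.hom_mult[of f "\<ominus>\<^bsub>?R\<^esub> g"] that by simp
    then show ?thesis
      using that free_tuple_ring_minus[of g] by (simp add: free_tuple_ring_simps a_minus_def)
  qed
  have fr: "frag_of t \<in> carrier ?R" if "t \<in> tuples A n" for t
    using that by (simp add: free_tuple_ring_simps)
  have frd: "f - g \<in> carrier ?R" if "f \<in> carrier ?R" "g \<in> carrier ?R" for f g
    using that keys_diff[of f g] by (auto simp: free_tuple_ring_simps)
  have rel0: "h r = \<zero>\<^bsub>G\<^esub>" if "r \<in> tensor_relators K A n" for r
    using that unfolding tensor_relators_def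
  proof (elim UnE CollectE exE conjE)
    fix t i x y
    assume r: "r = frag_of (t[i := x \<oplus>\<^bsub>A\<^esub> y]) - frag_of (t[i := x]) - frag_of (t[i := y])"
      and t: "t \<in> tuples A n" "i < n" "x \<in> carrier A" "y \<in> carrier A"
    have T: "t[i := x \<oplus>\<^bsub>A\<^esub> y] \<in> tuples A n" "t[i := x] \<in> tuples A n" "t[i := y] \<in> tuples A n"
      using t by (auto intro!: tuples_update)
    have "F (t[i := x \<oplus>\<^bsub>A\<^esub> y]) = F (t[i := x]) \<oplus>\<^bsub>G\<^esub> F (t[i := y])"
      using F t by (simp add: balanced_def)
    moreover have "(p \<oplus>\<^bsub>G\<^esub> q) \<ominus>\<^bsub>G\<^esub> p \<ominus>\<^bsub>G\<^esub> q = \<zero>\<^bsub>G\<^esub>" if "p \<in> carrier G" "q \<in> carrier G" for p q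
      using that G.r_neg[of "p \<oplus>\<^bsub>G\<^esub> q"] by (simp add: a_minus_def G.a_assoc G.minus_add)
    ultimately show "h r = \<zero>\<^bsub>G\<^esub>"
      unfolding r using T Fc by (simp add: h_diff fr frd hF)
  next
    fix t i j c
    assume r: "r = frag_of (t[i := c \<odot>\<^bsub>A\<^esub> (t ! i)]) - frag_of (t[j := c \<odot>\<^bsub>A\<^esub> (t ! j)])"
      and t: "t \<in> tuples A n" "i < n" "j < n" "c \<in> carrier K"
    have T: "t[i := c \<odot>\<^bsub>A\<^esub> (t ! i)] \<in> tuples A n" if "i < n" for i
      using that t by (intro tuples_update) (auto simp: tuples_iff)
    have "F (t[i := c \<odot>\<^bsub>A\<^esub> (t ! i)]) = F (t[j := c \<odot>\<^bsub>A\<^esub> (t ! j)])"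
      using F t unfolding balanced_def by blast
    then show "h r = \<zero>\<^bsub>G\<^esub>"
      unfolding r using T t Fc by (simp add: h_diff fr hF a_minus_def G.r_neg)
  qed
  have "?N \<subseteq> kernel (add_monoid ?R) (add_monoid G) h"
    unfolding tensor_null_def
  proof (rule N.add.generate_subgroup_incl)
    show "tensor_relators K A n \<subseteq> kernel (add_monoid ?R) (add_monoid G) h"
      using rel0 tensor_relators_carrier by (auto simp: kernel_def)
    show "subgroup (kernel (add_monoid ?R) (add_monoid G) h) (add_monoid ?R)"
      by (rule h.subgroup_kernel)
  qed
  then obtain g where g: "g \<in> hom (add_monoid ?R Mod ?N) (add_monoid G)"
    and gh: "\<And>f. f \<in> carrier (add_monoid ?R) \<Longrightarrow> g (?N #>\<^bsub>add_monoid ?R\<^esub> f) = h f"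
    using h.FactGroup_universal_kernel[OF N.a_normal] by metis
  show thesis
  proof (rule that)
    show "g \<in> hom (add_monoid (tensor_power K A n)) (add_monoid G)"
      using g by (simp add: hom_def tensor_power_def FactRing_def FactGroup_def
          A_RCOSETS_def set_add_def)
    show "g (tensor K A t) = F t" if "t \<in> tuples A n" for t
      using gh[of "frag_of t"] hF[OF that] fr[OF that] that
      by (simp add: tensor_def a_r_coset_def tuples_iff)
  qed
qed

end

section \<open>Threefold and fourfold tensors\<close>

lemma tuples_3_iff:
  "t \<in> tuples A 3 \<longleftrightarrow> (\<exists>a\<in>carrier A. \<exists>b\<in>carrier A. \<exists>c\<in>carrier A. t = [a, b, c])"
  by (auto simp: tuples_def length_Suc_conv numeral_3_eq_3)

lemma tuples_4_iff:
  "t \<in> tuples A 4 \<longleftrightarrow>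
    (\<exists>a\<in>carrier A. \<exists>b\<in>carrier A. \<exists>c\<in>carrier A. \<exists>d\<in>carrier A. t = [a, b, c, d])"
  by (auto simp: tuples_def length_Suc_conv eval_nat_numeral)

context assoc_algebra
begin

lemma tensor_3_closed [simp]:
  "\<lbrakk>a \<in> carrier A; b \<in> carrier A; c \<in> carrier A\<rbrakk> \<Longrightarrow>
    tensor K A [a, b, c] \<in> carrier (tensor_power K A 3)"
  by (simp add: tensor_closed tuples_3_iff)

lemma tensor_4_closed [simp]:
  "\<lbrakk>a \<in> carrier A; b \<in> carrier A; c \<in> carrier A; d \<in> carrier A\<rbrakk> \<Longrightarrow>
    tensor K A [a, b, c, d] \<in> carrier (tensor_power K A 4)"
  by (simp add: tensor_closed tuples_4_iff)

lemma tensor_3_mult [simp]: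
  "\<lbrakk>a \<in> carrier A; b \<in> carrier A; c \<in> carrier A; a' \<in> carrier A; b' \<in> carrier A; c' \<in> carrier A\<rbrakk> \<Longrightarrow>
    tensor K A [a, b, c] \<otimes>\<^bsub>tensor_power K A 3\<^esub> tensor K A [a', b', c'] =
    tensor K A [a \<otimes>\<^bsub>A\<^esub> a', b \<otimes>\<^bsub>A\<^esub> b', c \<otimes>\<^bsub>A\<^esub> c']"
  by (simp add: tensor_mult tuples_3_iff)

lemma tensor_3_one: "\<one>\<^bsub>tensor_power K A 3\<^esub> = tensor K A [\<one>\<^bsub>A\<^esub>, \<one>\<^bsub>A\<^esub>, \<one>\<^bsub>A\<^esub>]"
  by (simp add: tensor_one numeral_3_eq_3)

lemma tensor_3_add:
  assumes "a \<in> carrier A" "b \<in> carrier A" "c \<in> carrier A" "d \<in> carrier A"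
  shows "tensor K A [a \<oplus>\<^bsub>A\<^esub> b, c, d] =
      tensor K A [a, c, d] \<oplus>\<^bsub>tensor_power K A 3\<^esub> tensor K A [b, c, d]"
    and "tensor K A [c, a \<oplus>\<^bsub>A\<^esub> b, d] =
      tensor K A [c, a, d] \<oplus>\<^bsub>tensor_power K A 3\<^esub> tensor K A [c, b, d]"
    and "tensor K A [c, d, a \<oplus>\<^bsub>A\<^esub> b] =
      tensor K A [c, d, a] \<oplus>\<^bsub>tensor_power K A 3\<^esub> tensor K A [c, d, b]"
proof -
  have *: "tensor K A (t[i := a \<oplus>\<^bsub>A\<^esub> b]) =
      tensor K A (t[i := a]) \<oplus>\<^bsub>tensor_power K A 3\<^esub> tensor K A (t[i := b])"
    if "t \<in> tuples A 3" "i < 3" for t i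
    using balanced_tensor[of 3] that assms(1,2) by (simp add: balanced_def)
  show "tensor K A [a \<oplus>\<^bsub>A\<^esub> b, c, d] =
      tensor K A [a, c, d] \<oplus>\<^bsub>tensor_power K A 3\<^esub> tensor K A [b, c, d]"
    and "tensor K A [c, a \<oplus>\<^bsub>A\<^esub> b, d] =
      tensor K A [c, a, d] \<oplus>\<^bsub>tensor_power K A 3\<^esub> tensor K A [c, b, d]"
    and "tensor K A [c, d, a \<oplus>\<^bsub>A\<^esub> b] =
      tensor K A [c, d, a] \<oplus>\<^bsub>tensor_power K A 3\<^esub> tensor K A [c, d, b]"
    using *[of "[a, c, d]" 0] *[of "[c, a, d]" 1] *[of "[c, d, a]" 2] assms
    by (simp_all add: tuples_3_iff numeral_2_eq_2)
qed

text \<open>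
  Both equations move the scalar into the first slot, so that used as rewrite rules they bring
  any two monomials that differ by the position of a scalar to a common form.
\<close>

lemma tensor_3_smult:
  assumes "k \<in> carrier K" "a \<in> carrier A" "b \<in> carrier A" "c \<in> carrier A"
  shows "tensor K A [a, k \<odot>\<^bsub>A\<^esub> b, c] = tensor K A [k \<odot>\<^bsub>A\<^esub> a, b, c]"
    and "tensor K A [a, b, k \<odot>\<^bsub>A\<^esub> c] = tensor K A [k \<odot>\<^bsub>A\<^esub> a, b, c]"
proof -
  have "[a, b, c] \<in> tuples A 3" using assms by (simp add: tuples_3_iff)
  then have *: "tensor K A ([a, b, c][i := k \<odot>\<^bsub>A\<^esub> ([a, b, c] ! i)]) =
      tensor K A ([a, b, c][j := k \<odot>\<^bsub>A\<^esub> ([a, b, c] ! j)])" if "i < 3" "j < 3" for i j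
    using balanced_tensor[of 3] assms(1) that unfolding balanced_def by blast
  show "tensor K A [a, k \<odot>\<^bsub>A\<^esub> b, c] = tensor K A [k \<odot>\<^bsub>A\<^esub> a, b, c]"
    and "tensor K A [a, b, k \<odot>\<^bsub>A\<^esub> c] = tensor K A [k \<odot>\<^bsub>A\<^esub> a, b, c]"
    using *[of 1 0] *[of 2 0] by (simp_all add: numeral_2_eq_2)
qed

lemma balanced_lift_3:
  assumes G: "abelian_group G"
    and cl: "\<And>a b c. \<lbrakk>a \<in> carrier A; b \<in> carrier A; c \<in> carrier A\<rbrakk> \<Longrightarrow> f a b c \<in> carrier G"
    and add: "\<And>a b c d. \<lbrakk>a \<in> carrier A; b \<in> carrier A; c \<in> carrier A; d \<in> carrier A\<rbrakk> \<Longrightarrow>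
        f (a \<oplus>\<^bsub>A\<^esub> b) c d = f a c d \<oplus>\<^bsub>G\<^esub> f b c d \<and>
        f c (a \<oplus>\<^bsub>A\<^esub> b) d = f c a d \<oplus>\<^bsub>G\<^esub> f c b d \<and>
        f c d (a \<oplus>\<^bsub>A\<^esub> b) = f c d a \<oplus>\<^bsub>G\<^esub> f c d b"
    and smult: "\<And>k a b c. \<lbrakk>k \<in> carrier K; a \<in> carrier A; b \<in> carrier A; c \<in> carrier A\<rbrakk> \<Longrightarrow>
        f a (k \<odot>\<^bsub>A\<^esub> b) c = f (k \<odot>\<^bsub>A\<^esub> a) b c \<and> f a b (k \<odot>\<^bsub>A\<^esub> c) = f (k \<odot>\<^bsub>A\<^esub> a) b c"
  obtains h where "h \<in> hom (add_monoid (tensor_power K A 3)) (add_monoid G)"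
    and "\<And>a b c. \<lbrakk>a \<in> carrier A; b \<in> carrier A; c \<in> carrier A\<rbrakk> \<Longrightarrow>
      h (tensor K A [a, b, c]) = f a b c"
proof -
  have less3: "i = 0 \<or> i = 1 \<or> i = 2" if "i < 3" for i :: nat using that by auto
  have "balanced K A 3 G (\<lambda>t. f (t ! 0) (t ! 1) (t ! 2))"
    unfolding balanced_def
    by (auto simp: tuples_3_iff cl add smult numeral_2_eq_2 dest!: less3)
  from balanced_lift[OF G this] obtain h where
    h: "h \<in> hom (add_monoid (tensor_power K A 3)) (add_monoid G)"
    and ht: "\<And>t. t \<in> tuples A 3 \<Longrightarrow> h (tensor K A t) = f (t ! 0) (t ! 1) (t ! 2)" by blast
  have "h (tensor K A [a, b, c]) = f a b c"
    if "a \<in> carrier A" "b \<in> carrier A" "c \<in> carrier A" for a b c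
    using ht[of "[a, b, c]"] that by (simp add: tuples_3_iff numeral_2_eq_2)
  with h show thesis by (rule that)
qed

lemma balanced_lift_4:
  assumes G: "abelian_group G"
    and cl: "\<And>a b c d. \<lbrakk>a \<in> carrier A; b \<in> carrier A; c \<in> carrier A; d \<in> carrier A\<rbrakk> \<Longrightarrow>
        f a b c d \<in> carrier G"
    and add: "\<And>a b c d e. \<lbrakk>a \<in> carrier A; b \<in> carrier A; c \<in> carrier A; d \<in> carrier A; e \<in> carrier A\<rbrakk> \<Longrightarrow>
        f (a \<oplus>\<^bsub>A\<^esub> b) c d e = f a c d e \<oplus>\<^bsub>G\<^esub> f b c d e \<and>
        f c (a \<oplus>\<^bsub>A\<^esub> b) d e = f c a d e \<oplus>\<^bsub>G\<^esub> f c b d e \<and>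
        f c d (a \<oplus>\<^bsub>A\<^esub> b) e = f c d a e \<oplus>\<^bsub>G\<^esub> f c d b e \<and>
        f c d e (a \<oplus>\<^bsub>A\<^esub> b) = f c d e a \<oplus>\<^bsub>G\<^esub> f c d e b"
    and smult: "\<And>k a b c d. \<lbrakk>k \<in> carrier K; a \<in> carrier A; b \<in> carrier A; c \<in> carrier A; d \<in> carrier A\<rbrakk> \<Longrightarrow>
        f a (k \<odot>\<^bsub>A\<^esub> b) c d = f (k \<odot>\<^bsub>A\<^esub> a) b c d \<and>
        f a b (k \<odot>\<^bsub>A\<^esub> c) d = f (k \<odot>\<^bsub>A\<^esub> a) b c d \<and>
        f a b c (k \<odot>\<^bsub>A\<^esub> d) = f (k \<odot>\<^bsub>A\<^esub> a) b c d"
  obtains h where "h \<in> hom (add_monoid (tensor_power K A 4)) (add_monoid G)"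
    and "\<And>a b c d. \<lbrakk>a \<in> carrier A; b \<in> carrier A; c \<in> carrier A; d \<in> carrier A\<rbrakk> \<Longrightarrow>
      h (tensor K A [a, b, c, d]) = f a b c d"
proof -
  have less4: "i = 0 \<or> i = 1 \<or> i = 2 \<or> i = 3" if "i < 4" for i :: nat using that by auto
  have "balanced K A 4 G (\<lambda>t. f (t ! 0) (t ! 1) (t ! 2) (t ! 3))"
    unfolding balanced_def
    by (auto simp: tuples_4_iff cl add smult numeral_2_eq_2 numeral_3_eq_3 dest!: less4)
  from balanced_lift[OF G this] obtain h where
    h: "h \<in> hom (add_monoid (tensor_power K A 4)) (add_monoid G)"
    and ht: "\<And>t. t \<in> tuples A 4 \<Longrightarrow> h (tensor K A t) = f (t ! 0) (t ! 1) (t ! 2) (t ! 3)" by blast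
  have "h (tensor K A [a, b, c, d]) = f a b c d"
    if "a \<in> carrier A" "b \<in> carrier A" "c \<in> carrier A" "d \<in> carrier A" for a b c d
    using ht[of "[a, b, c, d]"] that by (simp add: tuples_4_iff numeral_2_eq_2 numeral_3_eq_3)
  with h show thesis by (rule that)
qed

end

context assoc_algebra
begin

section \<open>Monomial canonical R-matrices\<close>

text \<open>
  The first three identities in the definition of a canonical R-matrix multiply one slot of every
  summand by \<open>a\<close>.  Such sums are products of \<open>R\<close> with a monomial, hence they depend only on \<open>R\<close>
  and not on its decomposition.
\<close>

lemma finsum_tensor_3_mult:
  assumes cl: "\<forall>i<n. x i \<in> carrier A \<and> y i \<in> carrier A \<and> z i \<in> carrier A"
    and abc: "a \<in> carrier A" "b \<in> carrier A" "c \<in> carrier A"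
  defines "T \<equiv> tensor_power K A 3"
  defines "R \<equiv> \<Oplus>\<^bsub>T\<^esub>i\<in>{..<n::nat}. tensor K A [x i, y i, z i]"
  shows "R \<otimes>\<^bsub>T\<^esub> tensor K A [a, b, c] =
      (\<Oplus>\<^bsub>T\<^esub>i\<in>{..<n}. tensor K A [x i \<otimes>\<^bsub>A\<^esub> a, y i \<otimes>\<^bsub>A\<^esub> b, z i \<otimes>\<^bsub>A\<^esub> c])"
    and "tensor K A [a, b, c] \<otimes>\<^bsub>T\<^esub> R =
      (\<Oplus>\<^bsub>T\<^esub>i\<in>{..<n}. tensor K A [a \<otimes>\<^bsub>A\<^esub> x i, b \<otimes>\<^bsub>A\<^esub> y i, c \<otimes>\<^bsub>A\<^esub> z i])"
proof -
  interpret T: ring T unfolding T_def by (rule ring_tensor_power)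
  have F: "(\<lambda>i. tensor K A [x i, y i, z i]) \<in> {..<n} \<rightarrow> carrier T"
    using cl by (auto simp: T_def)
  have abcT: "tensor K A [a, b, c] \<in> carrier T" using abc by (simp add: T_def)
  have "R \<otimes>\<^bsub>T\<^esub> tensor K A [a, b, c] =
    (\<Oplus>\<^bsub>T\<^esub>i\<in>{..<n}. tensor K A [x i, y i, z i] \<otimes>\<^bsub>T\<^esub> tensor K A [a, b, c])"
    unfolding R_def by (rule T.finsum_ldistr) (use F abcT in auto)
  also have "\<dots> = (\<Oplus>\<^bsub>T\<^esub>i\<in>{..<n}. tensor K A [x i \<otimes>\<^bsub>A\<^esub> a, y i \<otimes>\<^bsub>A\<^esub> b, z i \<otimes>\<^bsub>A\<^esub> c])"
    by (rule T.finsum_cong') (use cl abc in \<open>auto simp: T_def\<close>)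
  finally show "R \<otimes>\<^bsub>T\<^esub> tensor K A [a, b, c] =
      (\<Oplus>\<^bsub>T\<^esub>i\<in>{..<n}. tensor K A [x i \<otimes>\<^bsub>A\<^esub> a, y i \<otimes>\<^bsub>A\<^esub> b, z i \<otimes>\<^bsub>A\<^esub> c])" .
  have "tensor K A [a, b, c] \<otimes>\<^bsub>T\<^esub> R =
    (\<Oplus>\<^bsub>T\<^esub>i\<in>{..<n}. tensor K A [a, b, c] \<otimes>\<^bsub>T\<^esub> tensor K A [x i, y i, z i])"
    unfolding R_def by (rule T.finsum_rdistr) (use F abcT in auto)
  also have "\<dots> = (\<Oplus>\<^bsub>T\<^esub>i\<in>{..<n}. tensor K A [a \<otimes>\<^bsub>A\<^esub> x i, b \<otimes>\<^bsub>A\<^esub> y i, c \<otimes>\<^bsub>A\<^esub> z i])"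
    by (rule T.finsum_cong') (use cl abc in \<open>auto simp: T_def\<close>)
  finally show "tensor K A [a, b, c] \<otimes>\<^bsub>T\<^esub> R =
      (\<Oplus>\<^bsub>T\<^esub>i\<in>{..<n}. tensor K A [a \<otimes>\<^bsub>A\<^esub> x i, b \<otimes>\<^bsub>A\<^esub> y i, c \<otimes>\<^bsub>A\<^esub> z i])" .
qed

lemma canonical_R_matrixE:
  assumes "canonical_R_matrix K A R"
  obtains n :: nat and x y z where
    "\<forall>i<n. x i \<in> carrier A \<and> y i \<in> carrier A \<and> z i \<in> carrier A"
    "R = (\<Oplus>\<^bsub>tensor_power K A 3\<^esub> i \<in> {..<n}. tensor K A [x i, y i, z i])"
    "\<forall>a \<in> carrier A.
      (\<Oplus>\<^bsub>tensor_power K A 3\<^esub> i \<in> {..<n}. tensor K A [a \<otimes>\<^bsub>A\<^esub> x i, y i, z i]) =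
      (\<Oplus>\<^bsub>tensor_power K A 3\<^esub> i \<in> {..<n}. tensor K A [x i, y i \<otimes>\<^bsub>A\<^esub> a, z i])"
    "\<forall>a \<in> carrier A.
      (\<Oplus>\<^bsub>tensor_power K A 3\<^esub> i \<in> {..<n}. tensor K A [x i, a \<otimes>\<^bsub>A\<^esub> y i, z i]) =
      (\<Oplus>\<^bsub>tensor_power K A 3\<^esub> i \<in> {..<n}. tensor K A [x i, y i, z i \<otimes>\<^bsub>A\<^esub> a])"
    "(\<Oplus>\<^bsub>tensor_power K A 4\<^esub> i \<in> {..<n}. tensor K A [x i, \<one>\<^bsub>A\<^esub>, y i, z i]) =
      (\<Oplus>\<^bsub>tensor_power K A 4\<^esub> i \<in> {..<n}. \<Oplus>\<^bsub>tensor_power K A 4\<^esub> j \<in> {..<n}.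
        tensor K A [x i, y i \<otimes>\<^bsub>A\<^esub> x j, y j, z i \<otimes>\<^bsub>A\<^esub> z j])"
  using assms unfolding canonical_R_matrix_def
  by (elim conjE exE) (rule that; assumption)

lemma canonical_R_matrix_centralizing:
  assumes can: "canonical_R_matrix K A R" and a: "a \<in> carrier A"
  shows "tensor K A [a, \<one>\<^bsub>A\<^esub>, \<one>\<^bsub>A\<^esub>] \<otimes>\<^bsub>tensor_power K A 3\<^esub> R =
    R \<otimes>\<^bsub>tensor_power K A 3\<^esub> tensor K A [\<one>\<^bsub>A\<^esub>, a, \<one>\<^bsub>A\<^esub>]"
    and "tensor K A [\<one>\<^bsub>A\<^esub>, a, \<one>\<^bsub>A\<^esub>] \<otimes>\<^bsub>tensor_power K A 3\<^esub> R =
    R \<otimes>\<^bsub>tensor_power K A 3\<^esub> tensor K A [\<one>\<^bsub>A\<^esub>, \<one>\<^bsub>A\<^esub>, a]"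
proof -
  let ?T = "tensor_power K A 3"
  interpret T: ring ?T by (rule ring_tensor_power)
  obtain n :: nat and x y z where
    cl: "\<forall>i<n. x i \<in> carrier A \<and> y i \<in> carrier A \<and> z i \<in> carrier A"
    and R: "R = (\<Oplus>\<^bsub>?T\<^esub>i\<in>{..<n}. tensor K A [x i, y i, z i])"
    and ax2: "(\<Oplus>\<^bsub>?T\<^esub>i\<in>{..<n}. tensor K A [a \<otimes>\<^bsub>A\<^esub> x i, y i, z i]) =
        (\<Oplus>\<^bsub>?T\<^esub>i\<in>{..<n}. tensor K A [x i, y i \<otimes>\<^bsub>A\<^esub> a, z i])"
    and ax3: "(\<Oplus>\<^bsub>?T\<^esub>i\<in>{..<n}. tensor K A [x i, a \<otimes>\<^bsub>A\<^esub> y i, z i]) =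
        (\<Oplus>\<^bsub>?T\<^esub>i\<in>{..<n}. tensor K A [x i, y i, z i \<otimes>\<^bsub>A\<^esub> a])"
    using can a by (elim canonical_R_matrixE) blast
  have drop: "(\<Oplus>\<^bsub>?T\<^esub>i\<in>{..<n}. tensor K A [p i, q i, r i]) =
      (\<Oplus>\<^bsub>?T\<^esub>i\<in>{..<n}. tensor K A [p' i, q' i, r' i])"
    if "\<And>i. i < n \<Longrightarrow> p' i \<in> carrier A \<and> q' i \<in> carrier A \<and> r' i \<in> carrier A"
      "\<And>i. i < n \<Longrightarrow> p i = p' i \<and> q i = q' i \<and> r i = r' i" for p q r p' q' r'
    by (rule T.finsum_cong') (use that in auto)
  have "tensor K A [a, \<one>\<^bsub>A\<^esub>, \<one>\<^bsub>A\<^esub>] \<otimes>\<^bsub>?T\<^esub> R = (\<Oplus>\<^bsub>?T\<^esub>i\<in>{..<n}. tensor K A [a \<otimes>\<^bsub>A\<^esub> x i, y i, z i])"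
    unfolding R finsum_tensor_3_mult[OF cl a A.one_closed A.one_closed]
    by (rule drop) (use cl a in auto)
  moreover have "R \<otimes>\<^bsub>?T\<^esub> tensor K A [\<one>\<^bsub>A\<^esub>, a, \<one>\<^bsub>A\<^esub>] =
      (\<Oplus>\<^bsub>?T\<^esub>i\<in>{..<n}. tensor K A [x i, y i \<otimes>\<^bsub>A\<^esub> a, z i])"
    unfolding R finsum_tensor_3_mult[OF cl A.one_closed a A.one_closed]
    by (rule drop) (use cl a in auto)
  ultimately show "tensor K A [a, \<one>\<^bsub>A\<^esub>, \<one>\<^bsub>A\<^esub>] \<otimes>\<^bsub>?T\<^esub> R = R \<otimes>\<^bsub>?T\<^esub> tensor K A [\<one>\<^bsub>A\<^esub>, a, \<one>\<^bsub>A\<^esub>]"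
    using ax2 by simp
  have "tensor K A [\<one>\<^bsub>A\<^esub>, a, \<one>\<^bsub>A\<^esub>] \<otimes>\<^bsub>?T\<^esub> R = (\<Oplus>\<^bsub>?T\<^esub>i\<in>{..<n}. tensor K A [x i, a \<otimes>\<^bsub>A\<^esub> y i, z i])"
    unfolding R finsum_tensor_3_mult[OF cl A.one_closed a A.one_closed]
    by (rule drop) (use cl a in auto)
  moreover have "R \<otimes>\<^bsub>?T\<^esub> tensor K A [\<one>\<^bsub>A\<^esub>, \<one>\<^bsub>A\<^esub>, a] =
      (\<Oplus>\<^bsub>?T\<^esub>i\<in>{..<n}. tensor K A [x i, y i, z i \<otimes>\<^bsub>A\<^esub> a])"
    unfolding R finsum_tensor_3_mult[OF cl A.one_closed A.one_closed a]
    by (rule drop) (use cl a in auto)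
  ultimately show "tensor K A [\<one>\<^bsub>A\<^esub>, a, \<one>\<^bsub>A\<^esub>] \<otimes>\<^bsub>?T\<^esub> R = R \<otimes>\<^bsub>?T\<^esub> tensor K A [\<one>\<^bsub>A\<^esub>, \<one>\<^bsub>A\<^esub>, a]"
    using ax3 by simp
qed

text \<open>
  Contract the identity \<open>R\<^sup>1 \<otimes> 1 \<otimes> R\<^sup>2 \<otimes> R\<^sup>3 = R\<^sup>1 \<otimes> R\<^sup>2r\<^sup>1 \<otimes> r\<^sup>2 \<otimes> R\<^sup>3r\<^sup>3\<close> along
  \<open>a \<otimes> b \<otimes> c \<otimes> d \<mapsto> ba \<otimes> c \<otimes> d\<close>.  This gives \<open>R = R\<^sup>2r\<^sup>1R\<^sup>1 \<otimes> r\<^sup>2 \<otimes> R\<^sup>3r\<^sup>3\<close>, and for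
  \<open>R = x \<otimes> y \<otimes> z\<close> the right-hand side is \<open>yxx \<otimes> y \<otimes> zz\<close>.

  The decomposition that witnesses the identity need not be the one-term sum \<open>x \<otimes> y \<otimes> z\<close>.  The
  copy \<open>r\<close> enters through multiplication by monomials from both sides and may thus be replaced by
  \<open>x \<otimes> y \<otimes> z\<close>; the remaining sum is the image of \<open>R\<close> under an additive map, which allows the same
  replacement for the other copy.
\<close>

lemma canonical_monomial_contraction:
  assumes can: "canonical_R_matrix K A (tensor K A [x, y, z])"
    and xyz: "x \<in> carrier A" "y \<in> carrier A" "z \<in> carrier A"
  shows "tensor K A [x, y, z] =
    tensor K A [y \<otimes>\<^bsub>A\<^esub> x, \<one>\<^bsub>A\<^esub>, z] \<otimes>\<^bsub>tensor_power K A 3\<^esub> tensor K A [x, y, z]"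
proof -
  let ?T = "tensor_power K A 3" and ?T4 = "tensor_power K A 4"
  interpret T: ring ?T by (rule ring_tensor_power)
  interpret T4: ring ?T4 by (rule ring_tensor_power)
  note T_ab = T.is_abelian_group and T4_ab = T4.is_abelian_group
  let ?R = "tensor K A [x, y, z]"
  obtain n :: nat and p q r where
    cl: "\<forall>i<n. p i \<in> carrier A \<and> q i \<in> carrier A \<and> r i \<in> carrier A"
    and R: "?R = (\<Oplus>\<^bsub>?T\<^esub>i\<in>{..<n}. tensor K A [p i, q i, r i])"
    and ax5: "(\<Oplus>\<^bsub>?T4\<^esub>i\<in>{..<n}. tensor K A [p i, \<one>\<^bsub>A\<^esub>, q i, r i]) =
      (\<Oplus>\<^bsub>?T4\<^esub>i\<in>{..<n}. \<Oplus>\<^bsub>?T4\<^esub>j\<in>{..<n}.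
        tensor K A [p i, q i \<otimes>\<^bsub>A\<^esub> p j, q j, r i \<otimes>\<^bsub>A\<^esub> r j])"
    using can by (elim canonical_R_matrixE) blast
  \<comment> \<open>the contraction of the first two slots\<close>
  obtain m where m: "m \<in> hom (add_monoid ?T4) (add_monoid ?T)"
    and mt: "\<And>a b c d. \<lbrakk>a \<in> carrier A; b \<in> carrier A; c \<in> carrier A; d \<in> carrier A\<rbrakk> \<Longrightarrow>
      m (tensor K A [a, b, c, d]) = tensor K A [b \<otimes>\<^bsub>A\<^esub> a, c, d]"
    by (rule balanced_lift_4[OF T_ab, of "\<lambda>a b c d. tensor K A [b \<otimes>\<^bsub>A\<^esub> a, c, d]"])
      (auto simp: A.l_distr A.r_distr tensor_3_add tensor_3_smult smult_mult_left smult_mult_right)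
  \<comment> \<open>what the contracted identity does to \<open>R\<close> once \<open>r = x \<otimes> y \<otimes> z\<close> is substituted\<close>
  obtain s where s: "s \<in> hom (add_monoid ?T) (add_monoid ?T)"
    and st: "\<And>a b c. \<lbrakk>a \<in> carrier A; b \<in> carrier A; c \<in> carrier A\<rbrakk> \<Longrightarrow>
      s (tensor K A [a, b, c]) = tensor K A [b \<otimes>\<^bsub>A\<^esub> x \<otimes>\<^bsub>A\<^esub> a, y, c \<otimes>\<^bsub>A\<^esub> z]"
    by (rule balanced_lift_3[OF T_ab, of "\<lambda>a b c. tensor K A [b \<otimes>\<^bsub>A\<^esub> x \<otimes>\<^bsub>A\<^esub> a, y, c \<otimes>\<^bsub>A\<^esub> z]"])
      (use xyz in \<open>auto simp: A.l_distr A.r_distr tensor_3_add tensor_3_smult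
        smult_mult_left smult_mult_right\<close>)
  have "?R = (\<Oplus>\<^bsub>?T\<^esub>i\<in>{..<n}. m (tensor K A [p i, \<one>\<^bsub>A\<^esub>, q i, r i]))"
    unfolding R by (rule T.finsum_cong') (use cl in \<open>auto simp: mt\<close>)
  also have "\<dots> = m (\<Oplus>\<^bsub>?T4\<^esub>i\<in>{..<n}. tensor K A [p i, \<one>\<^bsub>A\<^esub>, q i, r i])"
    by (rule additive_hom_finsum[OF T4_ab T_ab m, symmetric]) (use cl in auto)
  also have "\<dots> = (\<Oplus>\<^bsub>?T\<^esub>i\<in>{..<n}. m (\<Oplus>\<^bsub>?T4\<^esub>j\<in>{..<n}.
        tensor K A [p i, q i \<otimes>\<^bsub>A\<^esub> p j, q j, r i \<otimes>\<^bsub>A\<^esub> r j]))"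
    unfolding ax5
    by (rule additive_hom_finsum[OF T4_ab T_ab m]) (use cl in \<open>auto intro!: T4.finsum_closed\<close>)
  also have "\<dots> = (\<Oplus>\<^bsub>?T\<^esub>i\<in>{..<n}. s (tensor K A [p i, q i, r i]))"
  proof (rule T.finsum_cong')
    show "(\<lambda>i. s (tensor K A [p i, q i, r i])) \<in> {..<n} \<rightarrow> carrier ?T"
      using cl xyz by (auto simp: st)
    fix i assume "i \<in> {..<n}"
    then have i: "p i \<in> carrier A" "q i \<in> carrier A" "r i \<in> carrier A" using cl by auto
    have "m (\<Oplus>\<^bsub>?T4\<^esub>j\<in>{..<n}. tensor K A [p i, q i \<otimes>\<^bsub>A\<^esub> p j, q j, r i \<otimes>\<^bsub>A\<^esub> r j]) =
      (\<Oplus>\<^bsub>?T\<^esub>j\<in>{..<n}. m (tensor K A [p i, q i \<otimes>\<^bsub>A\<^esub> p j, q j, r i \<otimes>\<^bsub>A\<^esub> r j]))"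
      by (rule additive_hom_finsum[OF T4_ab T_ab m]) (use cl i in auto)
    also have "\<dots> = (\<Oplus>\<^bsub>?T\<^esub>j\<in>{..<n}.
        tensor K A [q i \<otimes>\<^bsub>A\<^esub> p j \<otimes>\<^bsub>A\<^esub> p i, \<one>\<^bsub>A\<^esub> \<otimes>\<^bsub>A\<^esub> q j \<otimes>\<^bsub>A\<^esub> \<one>\<^bsub>A\<^esub>, r i \<otimes>\<^bsub>A\<^esub> r j \<otimes>\<^bsub>A\<^esub> \<one>\<^bsub>A\<^esub>])"
      by (rule T.finsum_cong') (use cl i in \<open>auto simp: mt\<close>)
    also have "\<dots> = (tensor K A [q i, \<one>\<^bsub>A\<^esub>, r i] \<otimes>\<^bsub>?T\<^esub> ?R) \<otimes>\<^bsub>?T\<^esub> tensor K A [p i, \<one>\<^bsub>A\<^esub>, \<one>\<^bsub>A\<^esub>]"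
      unfolding R using cl i by (simp add: finsum_tensor_3_mult)
    also have "\<dots> = s (tensor K A [p i, q i, r i])"
      using i xyz by (simp add: st)
    finally show "m (\<Oplus>\<^bsub>?T4\<^esub>j\<in>{..<n}. tensor K A [p i, q i \<otimes>\<^bsub>A\<^esub> p j, q j, r i \<otimes>\<^bsub>A\<^esub> r j]) =
      s (tensor K A [p i, q i, r i])" .
  qed simp
  also have "\<dots> = s ?R"
    unfolding R by (rule additive_hom_finsum[OF T_ab T_ab s, symmetric]) (use cl in auto)
  also have "\<dots> = tensor K A [y \<otimes>\<^bsub>A\<^esub> x, \<one>\<^bsub>A\<^esub>, z] \<otimes>\<^bsub>?T\<^esub> ?R"
    using xyz by (simp add: st)
  finally show ?thesis .
qed

text \<open>
  Cancelling the invertible \<open>R = x \<otimes> y \<otimes> z\<close> in the contracted identity gives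
  \<open>yx \<otimes> 1 \<otimes> z = 1\<close>.  The identity \<open>aR\<^sup>1 \<otimes> R\<^sup>2 \<otimes> R\<^sup>3 = R\<^sup>1 \<otimes> R\<^sup>2a \<otimes> R\<^sup>3\<close> at \<open>a = y\<close> then reads
  \<open>1 \<otimes> y \<otimes> 1 = R(1 \<otimes> y \<otimes> 1)\<close>, and \<open>1 \<otimes> y \<otimes> 1\<close> has a right inverse because
  \<open>R = (1 \<otimes> y \<otimes> 1)(x \<otimes> 1 \<otimes> z)\<close> has one.
\<close>

lemma canonical_monomial_eq_one:
  assumes can: "canonical_R_matrix K A (tensor K A [x, y, z])"
    and xyz: "x \<in> carrier A" "y \<in> carrier A" "z \<in> carrier A"
  shows "tensor K A [x, y, z] = tensor K A [\<one>\<^bsub>A\<^esub>, \<one>\<^bsub>A\<^esub>, \<one>\<^bsub>A\<^esub>]"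
proof -
  let ?T = "tensor_power K A 3" and ?R = "tensor K A [x, y, z]"
  interpret T: ring ?T by (rule ring_tensor_power)
  have U: "?R \<in> Units ?T" using can by (simp add: canonical_R_matrix_def)
  define S where "S = inv\<^bsub>?T\<^esub> ?R"
  have S: "S \<in> carrier ?T" "?R \<otimes>\<^bsub>?T\<^esub> S = \<one>\<^bsub>?T\<^esub>" using U by (simp_all add: S_def)
  have R: "?R \<in> carrier ?T" using xyz by simp
  have yxz: "tensor K A [y \<otimes>\<^bsub>A\<^esub> x, \<one>\<^bsub>A\<^esub>, z] = \<one>\<^bsub>?T\<^esub>"
  proof -
    have "tensor K A [y \<otimes>\<^bsub>A\<^esub> x, \<one>\<^bsub>A\<^esub>, z] \<otimes>\<^bsub>?T\<^esub> (?R \<otimes>\<^bsub>?T\<^esub> S) = ?R \<otimes>\<^bsub>?T\<^esub> S"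
      using canonical_monomial_contraction[OF can xyz] S(1) R xyz
      by (simp add: T.m_assoc[symmetric] del: tensor_3_mult)
    then show ?thesis using S xyz by simp
  qed
  let ?Y = "tensor K A [\<one>\<^bsub>A\<^esub>, y, \<one>\<^bsub>A\<^esub>]" and ?W = "tensor K A [x, \<one>\<^bsub>A\<^esub>, z] \<otimes>\<^bsub>?T\<^esub> S"
  have Y: "?Y \<in> carrier ?T" using xyz by simp
  have W: "?W \<in> carrier ?T" using xyz S by simp
  have YW: "?Y \<otimes>\<^bsub>?T\<^esub> ?W = \<one>\<^bsub>?T\<^esub>"
    using xyz S T.m_assoc[of ?Y "tensor K A [x, \<one>\<^bsub>A\<^esub>, z]" S] by simp
  have "?R \<otimes>\<^bsub>?T\<^esub> ?Y = tensor K A [y, \<one>\<^bsub>A\<^esub>, \<one>\<^bsub>A\<^esub>] \<otimes>\<^bsub>?T\<^esub> ?R"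
    by (rule canonical_R_matrix_centralizing(1)[OF can xyz(2), symmetric])
  also have "\<dots> = ?Y \<otimes>\<^bsub>?T\<^esub> tensor K A [y \<otimes>\<^bsub>A\<^esub> x, \<one>\<^bsub>A\<^esub>, z]"
    using xyz by simp
  also have "\<dots> = ?Y" unfolding yxz using Y by simp
  finally have "?R \<otimes>\<^bsub>?T\<^esub> ?Y \<otimes>\<^bsub>?T\<^esub> ?W = ?Y \<otimes>\<^bsub>?T\<^esub> ?W" by simp
  then have "?R = \<one>\<^bsub>?T\<^esub>" using R Y W YW by (simp add: T.m_assoc del: tensor_3_mult)
  then show ?thesis by (simp add: tensor_3_one)
qed

section \<open>Epimorphisms and the canonical R-matrix \<open>1 \<otimes> 1 \<otimes> 1\<close>\<close>

lemma ring_hom_tensor_slots: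
  "(\<lambda>a. tensor K A [a, \<one>\<^bsub>A\<^esub>, \<one>\<^bsub>A\<^esub>]) \<in> ring_hom A (tensor_power K A 3)"
  "(\<lambda>a. tensor K A [\<one>\<^bsub>A\<^esub>, a, \<one>\<^bsub>A\<^esub>]) \<in> ring_hom A (tensor_power K A 3)"
  "(\<lambda>a. tensor K A [\<one>\<^bsub>A\<^esub>, \<one>\<^bsub>A\<^esub>, a]) \<in> ring_hom A (tensor_power K A 3)"
  by (auto intro!: ring_hom_memI simp: tensor_3_add tensor_3_one)

text \<open>
  The embeddings of \<open>A\<close> into the three slots of \<open>A \<otimes> A \<otimes> A\<close> agree on the scalars, so an
  epimorphism cannot tell them apart.
\<close>

lemma ring_epi_imp_slots_eq:
  assumes epi: "ring_epi K A (unit_map A)" and a: "a \<in> carrier A"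
  shows "tensor K A [\<one>\<^bsub>A\<^esub>, a, \<one>\<^bsub>A\<^esub>] = tensor K A [a, \<one>\<^bsub>A\<^esub>, \<one>\<^bsub>A\<^esub>]"
    and "tensor K A [\<one>\<^bsub>A\<^esub>, \<one>\<^bsub>A\<^esub>, a] = tensor K A [a, \<one>\<^bsub>A\<^esub>, \<one>\<^bsub>A\<^esub>]"
  by (rule ring_epi_cancel[OF epi ring_tensor_power[of 3] ring_hom_tensor_slots(2) ring_hom_tensor_slots(1)],
      simp add: unit_map_def tensor_3_smult, rule a)
     (rule ring_epi_cancel[OF epi ring_tensor_power[of 3] ring_hom_tensor_slots(3) ring_hom_tensor_slots(1)],
      simp add: unit_map_def tensor_3_smult, rule a)

lemma unit_map_ring_hom: "unit_map A \<in> ring_hom K A"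
  by (rule ring_hom_memI)
    (auto simp: unit_map_def smult_l_distr smult_assoc1 smult_mult_left)

text \<open>
  If \<open>f\<close> and \<open>g\<close> agree on the scalars then \<open>a \<otimes> b \<otimes> c \<mapsto> f(a)g(b)g(c)\<close> is well defined; it sends
  \<open>a \<otimes> 1 \<otimes> 1\<close> to \<open>f(a)\<close> and \<open>1 \<otimes> a \<otimes> 1\<close> to \<open>g(a)\<close>.
\<close>

lemma slots_eq_imp_ring_epi:
  assumes eq: "\<And>a. a \<in> carrier A \<Longrightarrow>
    tensor K A [a, \<one>\<^bsub>A\<^esub>, \<one>\<^bsub>A\<^esub>] = tensor K A [\<one>\<^bsub>A\<^esub>, a, \<one>\<^bsub>A\<^esub>]"
  shows "ring_epi K A (unit_map A)"
  unfolding ring_epi_def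
proof (intro conjI allI impI ballI unit_map_ring_hom)
  fix S :: "'a list ring" and f g a
  assume H: "ring S \<and> f \<in> ring_hom A S \<and> g \<in> ring_hom A S \<and>
    (\<forall>c\<in>carrier K. f (unit_map A c) = g (unit_map A c))" and a: "a \<in> carrier A"
  interpret S: ring S using H by simp
  have f: "f \<in> ring_hom A S" and g: "g \<in> ring_hom A S"
    and fg: "\<And>c. c \<in> carrier K \<Longrightarrow> f (unit_map A c) = g (unit_map A c)" using H by auto
  note hs = ring_hom_closed[OF f] ring_hom_closed[OF g] ring_hom_add[OF f] ring_hom_add[OF g]
    ring_hom_mult[OF f] ring_hom_mult[OF g] ring_hom_one[OF f] ring_hom_one[OF g]
  have u: "unit_map A k \<in> carrier A" if "k \<in> carrier K" for k
    using that by (simp add: unit_map_def)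
  have ul: "k \<odot>\<^bsub>A\<^esub> b = unit_map A k \<otimes>\<^bsub>A\<^esub> b" and ur: "k \<odot>\<^bsub>A\<^esub> b = b \<otimes>\<^bsub>A\<^esub> unit_map A k"
    if "k \<in> carrier K" "b \<in> carrier A" for k b
    using that by (simp_all add: unit_map_def smult_mult_left smult_mult_right)
  have fk: "f (k \<odot>\<^bsub>A\<^esub> b) = f b \<otimes>\<^bsub>S\<^esub> g (unit_map A k)" if "k \<in> carrier K" "b \<in> carrier A" for k b
    using that u by (simp add: ur hs fg)
  have gl: "g (k \<odot>\<^bsub>A\<^esub> b) = g (unit_map A k) \<otimes>\<^bsub>S\<^esub> g b" if "k \<in> carrier K" "b \<in> carrier A" for k b
    using that u by (simp add: ul hs)
  have gr: "g b \<otimes>\<^bsub>S\<^esub> g (unit_map A k) = g (unit_map A k) \<otimes>\<^bsub>S\<^esub> g b"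
    if "k \<in> carrier K" "b \<in> carrier A" for k b
    using that u by (simp add: hs(6)[symmetric] ul[symmetric] ur[symmetric])
  \<comment> \<open>\<open>g(k1)\<close> is central in the image of \<open>g\<close>, hence passes \<open>g(b)\<close>, and then equals \<open>f(k1)\<close>, which \<open>f(a)\<close> absorbs\<close>
  have slide: "f a \<otimes>\<^bsub>S\<^esub> g b \<otimes>\<^bsub>S\<^esub> g (k \<odot>\<^bsub>A\<^esub> c) = f (k \<odot>\<^bsub>A\<^esub> a) \<otimes>\<^bsub>S\<^esub> g b \<otimes>\<^bsub>S\<^esub> g c"
    if "k \<in> carrier K" "a \<in> carrier A" "b \<in> carrier A" "c \<in> carrier A" for k a b c
  proof -
    have cls: "f a \<in> carrier S" "g b \<in> carrier S" "g c \<in> carrier S" "g (unit_map A k) \<in> carrier S"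
      using that u hs by auto
    have "f a \<otimes>\<^bsub>S\<^esub> g b \<otimes>\<^bsub>S\<^esub> g (k \<odot>\<^bsub>A\<^esub> c) = f a \<otimes>\<^bsub>S\<^esub> (g b \<otimes>\<^bsub>S\<^esub> g (unit_map A k)) \<otimes>\<^bsub>S\<^esub> g c"
      using that cls by (simp add: gl S.m_assoc)
    also have "\<dots> = f (k \<odot>\<^bsub>A\<^esub> a) \<otimes>\<^bsub>S\<^esub> g b \<otimes>\<^bsub>S\<^esub> g c"
      using that cls by (simp add: gr fk S.m_assoc)
    finally show ?thesis .
  qed
  obtain h where h: "h \<in> hom (add_monoid (tensor_power K A 3)) (add_monoid S)"
    and ht: "\<And>a b c. \<lbrakk>a \<in> carrier A; b \<in> carrier A; c \<in> carrier A\<rbrakk> \<Longrightarrow>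
      h (tensor K A [a, b, c]) = f a \<otimes>\<^bsub>S\<^esub> g b \<otimes>\<^bsub>S\<^esub> g c"
    by (rule balanced_lift_3[OF S.is_abelian_group, of "\<lambda>a b c. f a \<otimes>\<^bsub>S\<^esub> g b \<otimes>\<^bsub>S\<^esub> g c"])
      (use u in \<open>auto simp: hs S.l_distr S.r_distr slide, auto simp: gl fk hs S.m_assoc\<close>)
  have "f a = h (tensor K A [a, \<one>\<^bsub>A\<^esub>, \<one>\<^bsub>A\<^esub>])" using a by (simp add: ht hs)
  also have "\<dots> = g a" using a by (simp add: eq ht hs)
  finally show "f a = g a" .
qed

text \<open>
  For \<open>R = 1 \<otimes> 1 \<otimes> 1\<close> the last two identities are trivial, and the first three say that an
  element of \<open>A\<close> gives the same tensor in each of the three slots.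
\<close>

lemma canonical_one_iff_ring_epi:
  "canonical_R_matrix K A (tensor K A [\<one>\<^bsub>A\<^esub>, \<one>\<^bsub>A\<^esub>, \<one>\<^bsub>A\<^esub>]) \<longleftrightarrow> ring_epi K A (unit_map A)"
proof
  let ?T = "tensor_power K A 3"
  interpret T: ring ?T by (rule ring_tensor_power)
  interpret T4: ring "tensor_power K A 4" by (rule ring_tensor_power)
  {
    assume can: "canonical_R_matrix K A (tensor K A [\<one>\<^bsub>A\<^esub>, \<one>\<^bsub>A\<^esub>, \<one>\<^bsub>A\<^esub>])"
    show "ring_epi K A (unit_map A)"
      by (rule slots_eq_imp_ring_epi)
        (use canonical_R_matrix_centralizing(1)[OF can] in simp)
  }
  assume epi: "ring_epi K A (unit_map A)"
  note slots = ring_epi_imp_slots_eq[OF epi]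
  have sum: "(\<Oplus>\<^bsub>G\<^esub>i\<in>{..<Suc 0}. t) = t" if "ring G" "t \<in> carrier G"
    for t and G :: "('a list \<Rightarrow>\<^sub>0 int) set ring"
  proof -
    interpret G: ring G by fact
    show ?thesis using that(2) by (simp add: lessThan_Suc)
  qed
  note s3 = sum[OF T.ring_axioms] and s4 = sum[OF T4.ring_axioms]
  show "canonical_R_matrix K A (tensor K A [\<one>\<^bsub>A\<^esub>, \<one>\<^bsub>A\<^esub>, \<one>\<^bsub>A\<^esub>])"
    unfolding canonical_R_matrix_def
  proof (intro conjI exI[of _ "Suc 0"] exI[of _ "\<lambda>i. \<one>\<^bsub>A\<^esub>"] ballI)
    show "tensor K A [\<one>\<^bsub>A\<^esub>, \<one>\<^bsub>A\<^esub>, \<one>\<^bsub>A\<^esub>] \<in> Units ?T"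
      using T.Units_one_closed by (simp add: tensor_3_one)
  qed (simp_all add: s3 s4, (metis slots)+)
qed

section \<open>Commutative algebras\<close>

text \<open>
  When \<open>A\<close> is commutative, \<open>R\<close> commutes with every monomial, and being invertible it cancels from
  the centralizing identities: an element of \<open>A\<close> gives the same tensor in each slot.  All factors
  of \<open>R\<close> can then be collected in the first slot.
\<close>

lemma canonical_commutative_monomial:
  assumes comm: "cring A" and can: "canonical_R_matrix K A R"
  obtains a where "a \<in> carrier A" "R = tensor K A [a, \<one>\<^bsub>A\<^esub>, \<one>\<^bsub>A\<^esub>]"
proof -
  let ?T = "tensor_power K A 3"
  interpret T: ring ?T by (rule ring_tensor_power)
  interpret C: cring A by (rule comm)
  obtain n :: nat and x y z where
    cl: "\<forall>i<n. x i \<in> carrier A \<and> y i \<in> carrier A \<and> z i \<in> carrier A"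
    and R: "R = (\<Oplus>\<^bsub>?T\<^esub>i\<in>{..<n}. tensor K A [x i, y i, z i])"
    using can by (elim canonical_R_matrixE) blast
  have U: "R \<in> Units ?T" using can by (simp add: canonical_R_matrix_def)
  have comm_R: "tensor K A [a, b, c] \<otimes>\<^bsub>?T\<^esub> R = R \<otimes>\<^bsub>?T\<^esub> tensor K A [a, b, c]"
    if abc: "a \<in> carrier A" "b \<in> carrier A" "c \<in> carrier A" for a b c
    unfolding R finsum_tensor_3_mult[OF cl abc]
    by (rule T.finsum_cong') (use cl abc in \<open>auto simp: C.m_comm\<close>)
  have slot2: "tensor K A [\<one>\<^bsub>A\<^esub>, a, \<one>\<^bsub>A\<^esub>] = tensor K A [a, \<one>\<^bsub>A\<^esub>, \<one>\<^bsub>A\<^esub>]"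
    and slot3: "tensor K A [\<one>\<^bsub>A\<^esub>, \<one>\<^bsub>A\<^esub>, a] = tensor K A [\<one>\<^bsub>A\<^esub>, a, \<one>\<^bsub>A\<^esub>]"
    if a: "a \<in> carrier A" for a
    using canonical_R_matrix_centralizing[OF can a] comm_R a T.Units_l_cancel[OF U] by simp_all
  have mono: "tensor K A [x i, y i, z i] = tensor K A [x i \<otimes>\<^bsub>A\<^esub> y i \<otimes>\<^bsub>A\<^esub> z i, \<one>\<^bsub>A\<^esub>, \<one>\<^bsub>A\<^esub>]"
    if "i < n" for i
  proof -
    have i: "x i \<in> carrier A" "y i \<in> carrier A" "z i \<in> carrier A" using cl that by auto
    have "tensor K A [x i, y i, z i] = tensor K A [x i, \<one>\<^bsub>A\<^esub>, \<one>\<^bsub>A\<^esub>] \<otimes>\<^bsub>?T\<^esub>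
      tensor K A [\<one>\<^bsub>A\<^esub>, y i, \<one>\<^bsub>A\<^esub>] \<otimes>\<^bsub>?T\<^esub> tensor K A [\<one>\<^bsub>A\<^esub>, \<one>\<^bsub>A\<^esub>, z i]"
      using i by simp
    also have "\<dots> = tensor K A [x i \<otimes>\<^bsub>A\<^esub> y i \<otimes>\<^bsub>A\<^esub> z i, \<one>\<^bsub>A\<^esub>, \<one>\<^bsub>A\<^esub>]"
      unfolding slot3[OF i(3)] slot2[OF i(3)] slot2[OF i(2)] using i by simp
    finally show ?thesis .
  qed
  define a where "a = (\<Oplus>\<^bsub>A\<^esub>i\<in>{..<n}. x i \<otimes>\<^bsub>A\<^esub> y i \<otimes>\<^bsub>A\<^esub> z i)"
  have a: "a \<in> carrier A" unfolding a_def by (rule M.finsum_closed) (use cl in auto)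
  have slot_hom: "(\<lambda>a. tensor K A [a, \<one>\<^bsub>A\<^esub>, \<one>\<^bsub>A\<^esub>]) \<in> hom (add_monoid A) (add_monoid ?T)"
    by (auto simp: hom_def tensor_3_add)
  have "R = (\<Oplus>\<^bsub>?T\<^esub>i\<in>{..<n}. tensor K A [x i \<otimes>\<^bsub>A\<^esub> y i \<otimes>\<^bsub>A\<^esub> z i, \<one>\<^bsub>A\<^esub>, \<one>\<^bsub>A\<^esub>])"
    unfolding R by (rule T.finsum_cong') (use cl mono in auto)
  also have "\<dots> = tensor K A [a, \<one>\<^bsub>A\<^esub>, \<one>\<^bsub>A\<^esub>]"
    unfolding a_def
    by (rule additive_hom_finsum[OF A.is_abelian_group T.is_abelian_group slot_hom, symmetric])
      (use cl in auto)
  finally show thesis using a that by blast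
qed

end

theorem proposition2p3:
  fixes K :: "('k, 'p) ring_scheme"
    and A :: "('k, 'a, 'm) module_scheme"
  assumes "assoc_algebra K A"
  shows "(\<forall>x \<in> carrier A. \<forall>y \<in> carrier A. \<forall>z \<in> carrier A.
            canonical_R_matrix K A (tensor K A [x, y, z]) \<longrightarrow>
            tensor K A [x, y, z] = tensor K A [\<one>\<^bsub>A\<^esub>, \<one>\<^bsub>A\<^esub>, \<one>\<^bsub>A\<^esub>]) \<and>
         (canonical_R_matrix K A (tensor K A [\<one>\<^bsub>A\<^esub>, \<one>\<^bsub>A\<^esub>, \<one>\<^bsub>A\<^esub>]) \<longleftrightarrow>
            ring_epi K A (unit_map A)) \<and>
         (cring A \<longrightarrow>
           (\<forall>R \<in> carrier (tensor_power K A 3).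
             canonical_R_matrix K A R \<longleftrightarrow>
             R = tensor K A [\<one>\<^bsub>A\<^esub>, \<one>\<^bsub>A\<^esub>, \<one>\<^bsub>A\<^esub>] \<and> ring_epi K A (unit_map A)))"
proof -
  interpret assoc_algebra K A by (rule assms)
  have "R = tensor K A [\<one>\<^bsub>A\<^esub>, \<one>\<^bsub>A\<^esub>, \<one>\<^bsub>A\<^esub>]"
    if comm: "cring A" and can: "canonical_R_matrix K A R" for R
  proof -
    obtain a where "a \<in> carrier A" "R = tensor K A [a, \<one>\<^bsub>A\<^esub>, \<one>\<^bsub>A\<^esub>]"
      by (rule canonical_commutative_monomial[OF comm can])
    then show ?thesis using can canonical_monomial_eq_one by simp
  qed
  then show ?thesis
    using canonical_monomial_eq_one canonical_one_iff_ring_epi by metis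
qed

end
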